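(* Let $\mathbb{K}$ be a field, $n,d$ positive integers, $R=\mathbb{K}[x_0,\dots,x_n]$, and let $\ell_0,\dots,\ell_n$ be positive integers with $N+1=\ell_0+\cdots+\ell_n$. Let $\widetilde R=\mathbb{K}[x_{ij}\mid 0\le i\le n,\ 1\le j\le \ell_i]$ be the polynomial ring in $N+1$ variables and let $\psi:\widetilde R\to R$ be the homomorphism $x_{ij}\mapsto x_i$. Let $\Omega_{n,d}$ be a set of monomials of degree $d$ in $R$, and let $\Omega_{N,d}\subset\widetilde R$ be the preimage of $\Omega_{n,d}$ under $\psi$, i.e. the set of all monomials of $\widetilde R$ whose image under $\psi$ lies in $\Omega_{n,d}$. Let $Y_{n,d}$ and $Y_{N,d}$ be the monomial projections parameterized by $\Omega_{n,d}$ and $\Omega_{N,d}$. If the ideal $\mathrm{I}(Y_{n,d})$ is generated in degrees at most $k$, then so is $\mathrm{I}(Y_{N,d})$. Moreover, if $\mathrm{I}(Y_{n,d})$ has a Gröbner basis of binomials of degrees at most $k$, then so does $\mathrm{I}(Y_{N,d})$.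
   Context: For a finite set $\Omega=\{m_1,\dots,m_\mu\}$ of monomials of degree $d$ in a polynomial ring $P$ over $\mathbb{K}$, the monomial projection $Y$ parameterized by $\Omega$ is the projective toric variety in $\mathbb{P}^{\mu-1}$ given by the closure of the image of the rational map defined by $\Omega$; its homogeneous ideal $\mathrm{I}(Y)$ is the kernel of the $\mathbb{K}$-algebra homomorphism $\mathbb{K}[w_1,\dots,w_\mu]\to P$, $w_i\mapsto m_i$, where $\mathbb{K}[w_1,\dots,w_\mu]$ is standard graded. Having a Gröbner basis of a given kind means with respect to some term order. Here $k$ is an integer.
   Formalization: The integer k is assumed to be at least 2; for k ≤ 1 the claim fails, e.g. n=1, d=2, Ω={x_0²}, ℓ=(2,1), where I(Y_{n,d})=0 but I(Y_{N,d}) is the ideal of a conic. *)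

theory Defs
  imports "HOL-Library.Poly_Mapping" "HOL-Algebra.Ideal"
begin

text \<open>
  A power product is a finitely supported exponent vector and a polynomial is a finitely
  supported family of coefficients indexed by power products.  The variables of a polynomial ring
  form an explicit set \<open>V\<close>, and \<open>mpoly_ring V\<close> is the ring of those
  polynomials in which only variables from \<open>V\<close> occur.
\<close>

type_synonym 'v pp = "'v \<Rightarrow>\<^sub>0 nat"
type_synonym ('v, 'a) mpoly = "('v \<Rightarrow>\<^sub>0 nat) \<Rightarrow>\<^sub>0 'a"

definition pps :: "'v set \<Rightarrow> 'v pp set" where
  "pps V = {t. Poly_Mapping.keys t \<subseteq> V}"

definition pp_degree :: "'v pp \<Rightarrow> nat" where
  "pp_degree t = (\<Sum>v\<in>Poly_Mapping.keys t. Poly_Mapping.lookup t v)"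

definition mpoly_ring :: "'v set \<Rightarrow> ('v, 'a::comm_ring_1) mpoly ring" where
  "mpoly_ring V =
    \<lparr>carrier = {p. Poly_Mapping.keys p \<subseteq> pps V}, mult = (*), one = 1, zero = 0, add = (+)\<rparr>"

lemma cring_mpoly_ring: "cring (mpoly_ring V :: ('v, 'a::comm_ring_1) mpoly ring)"
proof (rule cringI)
  have add: "s + t \<in> pps V" if "s \<in> pps V" "t \<in> pps V" for s t :: "'v pp"
    using that Poly_Mapping.keys_add[of s t] by (auto simp: pps_def)
  show "abelian_group (mpoly_ring V :: ('v, 'a) mpoly ring)"
  proof (rule abelian_groupI)
    fix p :: "('v, 'a) mpoly" assume "p \<in> carrier (mpoly_ring V)"
    then show "\<exists>q\<in>carrier (mpoly_ring V). q \<oplus>\<^bsub>mpoly_ring V\<^esub> p = \<zero>\<^bsub>mpoly_ring V\<^esub>"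
      by (intro bexI[of _ "- p"]) (auto simp: mpoly_ring_def)
  qed (use Poly_Mapping.keys_add in \<open>fastforce simp: mpoly_ring_def algebra_simps\<close>)+
  show "comm_monoid (mpoly_ring V :: ('v, 'a) mpoly ring)"
  proof (rule comm_monoidI)
    fix p q :: "('v, 'a) mpoly"
    assume "p \<in> carrier (mpoly_ring V)" "q \<in> carrier (mpoly_ring V)"
    then show "p \<otimes>\<^bsub>mpoly_ring V\<^esub> q \<in> carrier (mpoly_ring V)"
      using keys_mult[of p q] add by (fastforce simp: mpoly_ring_def)
  qed (auto simp: mpoly_ring_def algebra_simps pps_def)
qed (auto simp: mpoly_ring_def algebra_simps)

definition power_monomial :: "'v pp \<Rightarrow> ('v, 'a::comm_ring_1) mpoly" where
  "power_monomial t = Poly_Mapping.single t 1"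

definition mpoly_var :: "'v \<Rightarrow> ('v, 'a::comm_ring_1) mpoly" where
  "mpoly_var v = power_monomial (Poly_Mapping.single v 1)"

definition monomials :: "'v set \<Rightarrow> ('v, 'a::comm_ring_1) mpoly set" where
  "monomials V = power_monomial ` pps V"

definition monomials_of_degree :: "'v set \<Rightarrow> nat \<Rightarrow> ('v, 'a::comm_ring_1) mpoly set" where
  "monomials_of_degree V d = power_monomial ` {t \<in> pps V. pp_degree t = d}"

text \<open>The algebra homomorphism sending each variable \<open>v\<close> to \<open>\<sigma> v\<close>.\<close>

definition mpoly_hom ::
    "('v \<Rightarrow> ('w, 'a::comm_ring_1) mpoly) \<Rightarrow> ('v, 'a) mpoly \<Rightarrow> ('w, 'a) mpoly" where
  "mpoly_hom \<sigma> p =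
    (\<Sum>t\<in>Poly_Mapping.keys p. Poly_Mapping.single 0 (Poly_Mapping.lookup p t) *
      (\<Prod>v\<in>Poly_Mapping.keys t. \<sigma> v ^ Poly_Mapping.lookup t v))"

text \<open>
  The homogeneous ideal of the monomial projection parameterized by a set \<open>\<Omega>\<close> of
  monomials in the variables \<open>V\<close>.  The monomials themselves serve as names of the variables
  of the ambient ring: instead of \<open>w\<^sub>1, \<dots>, w\<^sub>\<mu>\<close> with
  \<open>w\<^sub>i \<mapsto> m\<^sub>i\<close> there is one variable for each \<open>m \<in> \<Omega>\<close>, and it is
  sent to \<open>m\<close>.
\<close>

definition projection_ideal ::
    "'v set \<Rightarrow> ('v, 'a::field) mpoly set \<Rightarrow> (('v, 'a) mpoly, 'a) mpoly set" where
  "projection_ideal V \<Omega> = a_kernel (mpoly_ring \<Omega>) (mpoly_ring V) (mpoly_hom (\<lambda>m. m))"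

definition homogeneous_of_degree :: "nat \<Rightarrow> ('v, 'a::comm_ring_1) mpoly \<Rightarrow> bool" where
  "homogeneous_of_degree e p \<longleftrightarrow> (\<forall>t\<in>Poly_Mapping.keys p. pp_degree t = e)"

definition generated_in_degrees_le :: "'v set \<Rightarrow> int \<Rightarrow> ('v, 'a::comm_ring_1) mpoly set \<Rightarrow> bool" where
  "generated_in_degrees_le V k I \<longleftrightarrow>
    (\<exists>G \<subseteq> carrier (mpoly_ring V).
      (\<forall>g\<in>G. \<exists>e. int e \<le> k \<and> homogeneous_of_degree e g) \<and> I = Idl\<^bsub>mpoly_ring V\<^esub> G)"

text \<open>
  A term order contains the pair \<open>(s, t)\<close> when \<open>s\<close> is at most \<open>t\<close>.
  It is only used for finite \<open>V\<close>, where the conditions below imply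
  well-foundedness by Dickson's lemma.
\<close>

definition term_order :: "'v set \<Rightarrow> ('v pp \<times> 'v pp) set \<Rightarrow> bool" where
  "term_order V r \<longleftrightarrow>
    linear_order_on (pps V) r \<and>
    (\<forall>t\<in>pps V. (0, t) \<in> r) \<and>
    (\<forall>s\<in>pps V. \<forall>t\<in>pps V. \<forall>u\<in>pps V. (s, t) \<in> r \<longrightarrow> (s + u, t + u) \<in> r)"

definition leading_pp :: "('v pp \<times> 'v pp) set \<Rightarrow> ('v, 'a::comm_ring_1) mpoly \<Rightarrow> 'v pp" where
  "leading_pp r p = (THE t. t \<in> Poly_Mapping.keys p \<and> (\<forall>s\<in>Poly_Mapping.keys p. (s, t) \<in> r))"

definition initial_ideal ::
    "'v set \<Rightarrow> ('v pp \<times> 'v pp) set \<Rightarrow> ('v, 'a::comm_ring_1) mpoly set \<Rightarrow> ('v, 'a) mpoly set" where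
  "initial_ideal V r F = Idl\<^bsub>mpoly_ring V\<^esub> ((\<lambda>p. power_monomial (leading_pp r p)) ` (F - {0}))"

definition groebner_basis ::
    "'v set \<Rightarrow> ('v pp \<times> 'v pp) set \<Rightarrow> ('v, 'a::field) mpoly set \<Rightarrow> ('v, 'a) mpoly set \<Rightarrow> bool" where
  "groebner_basis V r G I \<longleftrightarrow>
    finite G \<and> G \<subseteq> I \<and> initial_ideal V r G = initial_ideal V r I"

definition binomial :: "('v, 'a::comm_ring_1) mpoly \<Rightarrow> bool" where
  "binomial p \<longleftrightarrow> card (Poly_Mapping.keys p) = 2"

definition has_binomial_groebner_basis_le ::
    "'v set \<Rightarrow> int \<Rightarrow> ('v, 'a::field) mpoly set \<Rightarrow> bool" where
  "has_binomial_groebner_basis_le V k I \<longleftrightarrow>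
    (\<exists>r G. term_order V r \<and> groebner_basis V r G I \<and>
      (\<forall>g\<in>G. binomial g \<and> (\<forall>t\<in>Poly_Mapping.keys g. int (pp_degree t) \<le> k)))"

definition split_vars :: "nat \<Rightarrow> (nat \<Rightarrow> nat) \<Rightarrow> (nat \<times> nat) set" where
  "split_vars n l = {(i, j). i \<le> n \<and> 1 \<le> j \<and> j \<le> l i}"

definition collapse_hom :: "(nat \<times> nat, 'a::comm_ring_1) mpoly \<Rightarrow> (nat, 'a) mpoly" where
  "collapse_hom = mpoly_hom (\<lambda>(i, j). mpoly_var i)"

end

theory Submission
  imports Defs "HOL-Library.Product_Lexorder"
begin

text \<open>
  Both ideals are spanned by differences \<open>t - s\<close> of monomials with equal images.  The collapse
  \<open>x\<^sub>i\<^sub>j \<mapsto> x\<^sub>i\<close> renames the variables of the upper ambient ring to those of the lower one.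
  A move that replaces a factor \<open>a\<close> by \<open>b\<close> downstairs lifts along this renaming, because a
  monomial whose collapse is a product splits into factors with the prescribed collapses.  Hence
  moves of degree at most \<open>k\<close> reduce everything to pairs \<open>s, t\<close> with the same renaming.  Those are
  connected by quadratic exchanges of some \<open>x\<^sub>i\<^sub>j\<close> in one variable with some \<open>x\<^sub>i\<^sub>j\<^sub>'\<close> in another,
  which is where \<open>k \<ge> 2\<close> enters.  The exchanges can be directed by a reverse lexicographic order,
  so breaking ties of the lower term order by this order gives a term order for which the binomials
  of degree at most \<open>k\<close> form a Groebner basis.
\<close>

subsection \<open>Power products\<close>

definition pp_var :: "'v \<Rightarrow> 'v pp" where
  "pp_var v = Poly_Mapping.single v 1"

lemma lookup_pp_var: "Poly_Mapping.lookup (pp_var v) u = (if u = v then 1 else 0)"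
  by (simp add: pp_var_def lookup_single when_def)

lemma keys_pp_var [simp]: "Poly_Mapping.keys (pp_var v) = {v}"
  by (simp add: pp_var_def)

lemma keys_add_pp [simp]:
  fixes s t :: "'v pp"
  shows "Poly_Mapping.keys (s + t) = Poly_Mapping.keys s \<union> Poly_Mapping.keys t"
  by (auto simp: in_keys_iff lookup_add)

lemma zero_in_pps [simp]: "0 \<in> pps V"
  by (simp add: pps_def)

lemma add_in_pps_iff [simp]: "s + t \<in> pps V \<longleftrightarrow> s \<in> pps V \<and> t \<in> pps V"
  by (auto simp: pps_def)

lemma pp_var_in_pps_iff [simp]: "pp_var v \<in> pps V \<longleftrightarrow> v \<in> V"
  by (auto simp: pps_def)

lemma pp_remove_var:
  assumes "v \<in> Poly_Mapping.keys t"
  obtains t' :: "'v pp" where "t = pp_var v + t'"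
proof
  show "t = pp_var v + (t - pp_var v)"
    using assms by (intro poly_mapping_eqI) (auto simp: lookup_add lookup_minus lookup_pp_var in_keys_iff)
qed

lemma pp_degree_superset:
  assumes "finite S" "Poly_Mapping.keys t \<subseteq> S"
  shows "pp_degree t = (\<Sum>v\<in>S. Poly_Mapping.lookup t v)"
  unfolding pp_degree_def using assms by (intro sum.mono_neutral_left) (auto simp: in_keys_iff)

lemma pp_degree_zero [simp]: "pp_degree 0 = 0"
  by (simp add: pp_degree_def)

lemma pp_degree_pp_var [simp]: "pp_degree (pp_var v) = 1"
  by (simp add: pp_degree_def lookup_pp_var)

lemma pp_degree_add [simp]: "pp_degree (s + t) = pp_degree s + pp_degree t"
proof -
  let ?S = "Poly_Mapping.keys s \<union> Poly_Mapping.keys t"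
  show ?thesis
    by (subst (1 2 3) pp_degree_superset[of ?S]) (auto simp: lookup_add sum.distrib)
qed

lemma pp_induct [case_names zero add]:
  fixes t :: "'v pp"
  assumes "P 0" and "\<And>v t. P t \<Longrightarrow> P (pp_var v + t)"
  shows "P t"
proof (induction "pp_degree t" arbitrary: t)
  case 0
  then have "t = 0"
    by (intro poly_mapping_eqI) (auto simp: pp_degree_def in_keys_iff)
  then show ?case
    using assms(1) by simp
next
  case (Suc n)
  then have "Poly_Mapping.keys t \<noteq> {}"
    by (auto simp: pp_degree_def)
  then obtain v where "v \<in> Poly_Mapping.keys t"
    by blast
  then obtain t' where "t = pp_var v + t'"
    by (rule pp_remove_var)
  then show ?case
    using Suc assms(2) by simp
qed

lemma pps_induct [consumes 1, case_names zero add]: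
  assumes "t \<in> pps V" and "P 0"
    and "\<And>v t. v \<in> V \<Longrightarrow> t \<in> pps V \<Longrightarrow> P t \<Longrightarrow> P (pp_var v + t)"
  shows "P t"
  using assms(1) by (induction t rule: pp_induct) (auto intro: assms)

lemma finite_pps_degree_le:
  assumes "finite V"
  shows "finite {t \<in> pps V. pp_degree t \<le> D}"
proof (rule finite_imageD)
  let ?T = "{t \<in> pps V. pp_degree t \<le> D}"
  have "Poly_Mapping.lookup t v \<le> D" if "t \<in> ?T" for t v
  proof (cases "v \<in> Poly_Mapping.keys t")
    case True
    then have "Poly_Mapping.lookup t v \<le> pp_degree t"
      unfolding pp_degree_def by (intro member_le_sum) auto
    then show ?thesis
      using that by simp
  qed (simp add: in_keys_iff)
  moreover have "Poly_Mapping.lookup t v = 0" if "t \<in> ?T" "v \<notin> V" for t v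
    using that by (auto simp: pps_def in_keys_iff)
  ultimately have "Poly_Mapping.lookup ` ?T \<subseteq>
      {f. \<forall>v. (v \<in> V \<longrightarrow> f v \<in> {..D}) \<and> (v \<notin> V \<longrightarrow> f v = 0)}"
    by auto
  then show "finite (Poly_Mapping.lookup ` ?T)"
    by (rule finite_subset) (rule finite_set_of_finite_funs[OF assms finite_atMost])
  show "inj_on Poly_Mapping.lookup ?T"
    by (rule inj_onI, rule poly_mapping_eqI) simp
qed

lemma pp_cancel_common:
  fixes s t :: "'v pp"
  obtains g s' t' where "s = g + s'" "t = g + t'"
    "Poly_Mapping.keys s' \<inter> Poly_Mapping.keys t' = {}"
proof
  \<comment> \<open>Subtraction of exponents is truncated at zero, so \<open>s - (s - t)\<close> is
    the pointwise minimum, that is, the gcd of the two power products.\<close>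
  show "s = (s - (s - t)) + (s - t)" "t = (s - (s - t)) + (t - s)"
    by (intro poly_mapping_eqI, simp add: lookup_add lookup_minus)+
  show "Poly_Mapping.keys (s - t) \<inter> Poly_Mapping.keys (t - s) = {}"
    by (auto simp: in_keys_iff lookup_minus)
qed

text \<open>The monoid homomorphism determined by its values on the variables. The inner sum is a
  natural multiple of \<open>e v\<close>, written as a repeated sum so that it makes sense in any
  commutative monoid.\<close>

definition pp_extend :: "('v \<Rightarrow> 'b::comm_monoid_add) \<Rightarrow> 'v pp \<Rightarrow> 'b" where
  "pp_extend e t = (\<Sum>v\<in>Poly_Mapping.keys t. \<Sum>_<Poly_Mapping.lookup t v. e v)"

lemma pp_extend_superset:
  assumes "finite S" "Poly_Mapping.keys t \<subseteq> S"
  shows "pp_extend e t = (\<Sum>v\<in>S. \<Sum>_<Poly_Mapping.lookup t v. e v)"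
  unfolding pp_extend_def using assms by (intro sum.mono_neutral_left) (auto simp: in_keys_iff)

lemma pp_extend_zero [simp]: "pp_extend e 0 = 0"
  by (simp add: pp_extend_def)

lemma pp_extend_pp_var [simp]: "pp_extend e (pp_var v) = e v"
  by (simp add: pp_extend_def lookup_pp_var)

lemma pp_extend_add [simp]:
  fixes e :: "'v \<Rightarrow> 'b::comm_monoid_add"
  shows "pp_extend e (s + t) = pp_extend e s + pp_extend e t"
proof -
  let ?S = "Poly_Mapping.keys s \<union> Poly_Mapping.keys t"
  have split: "(\<Sum>_<a + b. c) = (\<Sum>_<a. c) + (\<Sum>_<b. c)" for a b :: nat and c :: 'b
    by (induction b) (simp_all add: add_ac)
  show ?thesis
    by (subst (1 2 3) pp_extend_superset[of ?S]) (auto simp: lookup_add split sum.distrib)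
qed

lemma pp_degree_pp_extend:
  assumes "\<And>v. v \<in> V \<Longrightarrow> pp_degree (e v) = d" "t \<in> pps V"
  shows "pp_degree (pp_extend e t) = d * pp_degree t"
  using assms(2) by (induction t rule: pps_induct) (simp_all add: assms(1))

subsection \<open>Renaming the indices of a finitely supported family\<close>

text \<open>Pushforward, used at two levels: on power products it renames variables, on polynomials
  it is the linear extension of a map of power products.\<close>

definition push :: "('k \<Rightarrow> 'l) \<Rightarrow> ('k \<Rightarrow>\<^sub>0 'c::comm_monoid_add) \<Rightarrow> ('l \<Rightarrow>\<^sub>0 'c)" where
  "push f p = (\<Sum>k\<in>Poly_Mapping.keys p. Poly_Mapping.single (f k) (Poly_Mapping.lookup p k))"

lemma push_superset:
  assumes "finite S" "Poly_Mapping.keys p \<subseteq> S"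
  shows "push f p = (\<Sum>k\<in>S. Poly_Mapping.single (f k) (Poly_Mapping.lookup p k))"
  unfolding push_def using assms by (intro sum.mono_neutral_left) (auto simp: in_keys_iff)

lemma push_zero [simp]: "push f 0 = 0"
  by (simp add: push_def)

lemma push_single [simp]: "push f (Poly_Mapping.single k c) = Poly_Mapping.single (f k) c"
  by (simp add: push_def)

lemma push_add [simp]: "push f (p + q) = push f p + push f q"
proof -
  let ?S = "Poly_Mapping.keys p \<union> Poly_Mapping.keys q"
  show ?thesis
    using Poly_Mapping.keys_add[of p q]
    by (subst (1 2 3) push_superset[of ?S]) (auto simp: lookup_add single_add sum.distrib)
qed

lemma push_diff [simp]:
  fixes p q :: "'k \<Rightarrow>\<^sub>0 'c::ab_group_add"
  shows "push f (p - q) = push f p - push f q"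
  using push_add[of f "p - q" q] by simp

lemma push_pp_var [simp]: "push f (pp_var v) = pp_var (f v)"
  by (simp add: pp_var_def)

lemma lookup_push:
  "Poly_Mapping.lookup (push f p) u =
    (\<Sum>k\<in>Poly_Mapping.keys p. Poly_Mapping.lookup p k when f k = u)"
  by (simp add: push_def lookup_sum lookup_single)

lemma keys_push_pp [simp]:
  fixes t :: "'v pp"
  shows "Poly_Mapping.keys (push f t) = f ` Poly_Mapping.keys t"
  by (induction t rule: pp_induct) auto

lemma push_pp_eq_zero_iff [simp]:
  fixes t :: "'v pp"
  shows "push f t = 0 \<longleftrightarrow> t = 0"
  by (metis keys_eq_empty keys_push_pp image_is_empty)

lemma push_in_pps:
  assumes "f ` V \<subseteq> W" "t \<in> pps V"
  shows "push f t \<in> pps W"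
  using assms by (auto simp: pps_def)

lemma pp_degree_push [simp]: "pp_degree (push f t) = pp_degree t"
  by (induction t rule: pp_induct) auto

text \<open>After cancellation of the common part, the supports are disjoint but have the same
  image. Injectivity makes them equal, hence empty.\<close>

lemma inj_on_push:
  assumes "inj_on f V"
  shows "inj_on (push f :: 'v pp \<Rightarrow> 'w pp) (pps V)"
proof (rule inj_onI)
  fix s t :: "'v pp" assume st: "s \<in> pps V" "t \<in> pps V" "push f s = push f t"
  obtain g s' t' where g: "s = g + s'" "t = g + t'"
    "Poly_Mapping.keys s' \<inter> Poly_Mapping.keys t' = {}"
    by (rule pp_cancel_common)
  then have "f ` Poly_Mapping.keys s' = f ` Poly_Mapping.keys t'"
    using st(3) by (metis push_add add_left_cancel keys_push_pp)
  moreover have "Poly_Mapping.keys s' \<subseteq> V" "Poly_Mapping.keys t' \<subseteq> V"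
    using g st by (auto simp: pps_def)
  ultimately have "Poly_Mapping.keys s' = Poly_Mapping.keys t'"
    using assms by (simp add: inj_on_image_eq_iff)
  then show "s = t"
    using g by simp
qed

text \<open>After cancelling the common part of \<open>s\<close> and \<open>t\<close>, the remaining parts have
  disjoint supports with the same image under \<open>f\<close>.\<close>

lemma push_eq_exponent_exchange:
  fixes s t :: "'v pp"
  assumes "push f s = push f t" "Poly_Mapping.lookup s x < Poly_Mapping.lookup t x"
  obtains y where "f y = f x" "Poly_Mapping.lookup t y < Poly_Mapping.lookup s y"
proof -
  obtain g s' t' where g: "s = g + s'" "t = g + t'"
    "Poly_Mapping.keys s' \<inter> Poly_Mapping.keys t' = {}"
    by (rule pp_cancel_common)
  have "f ` Poly_Mapping.keys s' = f ` Poly_Mapping.keys t'"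
    using assms(1) g by (metis push_add add_left_cancel keys_push_pp)
  moreover have "x \<in> Poly_Mapping.keys t'"
    using assms(2) g by (auto simp: in_keys_iff lookup_add)
  ultimately obtain y where "y \<in> Poly_Mapping.keys s'" "f y = f x"
    by (metis image_iff)
  moreover from this have "y \<notin> Poly_Mapping.keys t'"
    using g(3) by blast
  ultimately show ?thesis
    using that[of y] g by (auto simp: in_keys_iff lookup_add)
qed

text \<open>By induction on \<open>t\<close>: for a variable \<open>v\<close> of \<open>t\<close>,
  \<open>f v\<close> occurs in \<open>a\<close> or in \<open>b\<close>, and \<open>v\<close> is
  assigned to the corresponding factor.\<close>

lemma push_eq_add_split:
  fixes t a b :: "_ pp"
  assumes "push f t = a + b"
  obtains t1 t2 where "t = t1 + t2" "push f t1 = a" "push f t2 = b"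
proof -
  have "\<exists>t1 t2. t = t1 + t2 \<and> push f t1 = a \<and> push f t2 = b"
    using assms
  proof (induction t arbitrary: a b rule: pp_induct)
    case zero
    then have "a = 0" "b = 0"
      by (metis keys_add_pp keys_eq_empty push_zero Un_empty keys_zero)+
    then show ?case
      by (intro exI[of _ 0]) simp
  next
    case (add v t)
    have step: "\<exists>t1 t2. pp_var v + t = t1 + t2 \<and> push f t1 = a \<and> push f t2 = b"
      if eq: "push f (pp_var v + t) = a + b" and a: "f v \<in> Poly_Mapping.keys a" for a b
    proof -
      obtain a' where a': "a = pp_var (f v) + a'"
        using a by (rule pp_remove_var)
      then have "push f t = a' + b"
        using eq by (simp add: add.assoc)
      then obtain t1 t2 where "t = t1 + t2" "push f t1 = a'" "push f t2 = b"
        using add.IH by blast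
      then show ?thesis
        using a' by (intro exI[of _ "pp_var v + t1"] exI[of _ t2]) (simp add: add_ac)
    qed
    have "f v \<in> Poly_Mapping.keys (push f (pp_var v + t))"
      by simp
    then consider "f v \<in> Poly_Mapping.keys a" | "f v \<in> Poly_Mapping.keys b"
      unfolding add.prems by auto
    then show ?case
    proof cases
      case 2
      with step[of b a] add.prems show ?thesis
        by (metis add.commute)
    qed (use step add.prems in blast)
  qed
  with that show ?thesis
    by blast
qed

lemma pp_extend_push: "pp_extend e (push f t) = pp_extend (\<lambda>v. e (f v)) t"
  by (induction t rule: pp_induct) auto

lemma push_pp_extend: "push f (pp_extend e t) = pp_extend (\<lambda>v. push f (e v)) t"
  by (induction t rule: pp_induct) auto

lemma pp_extend_cong_pps:
  assumes "t \<in> pps V" "\<And>v. v \<in> V \<Longrightarrow> e v = e' v"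
  shows "pp_extend e t = pp_extend e' t"
  using assms(1) by (induction t rule: pps_induct) (simp_all add: assms(2))

lemma pp_extend_in_pps:
  assumes "t \<in> pps V" "\<And>v. v \<in> V \<Longrightarrow> e v \<in> pps X"
  shows "pp_extend e t \<in> pps X"
  using assms(1) by (induction t rule: pps_induct) (simp_all add: assms(2))

lemma lookup_le_pp_extend:
  fixes e :: "'v \<Rightarrow> 'x pp"
  assumes "v \<in> Poly_Mapping.keys t"
  shows "Poly_Mapping.lookup (e v) x \<le> Poly_Mapping.lookup (pp_extend e t) x"
  using assms by (elim pp_remove_var) (simp add: lookup_add)

lemma in_keys_pp_extendE:
  fixes e :: "'v \<Rightarrow> 'x pp"
  assumes "x \<in> Poly_Mapping.keys (pp_extend e t)"
  obtains v where "v \<in> Poly_Mapping.keys t" "x \<in> Poly_Mapping.keys (e v)"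
proof -
  have "\<exists>v\<in>Poly_Mapping.keys t. x \<in> Poly_Mapping.keys (e v)"
    using assms by (induction t rule: pp_induct) auto
  with that show ?thesis
    by blast
qed

section \<open>The lexicographic order on power products\<close>

lemma pp_lessE:
  fixes s t :: "'k::linorder pp"
  assumes "s < t"
  obtains k where "Poly_Mapping.lookup s k < Poly_Mapping.lookup t k"
    "\<And>j. j < k \<Longrightarrow> Poly_Mapping.lookup s j = Poly_Mapping.lookup t j"
  using assms by (auto simp: less_poly_mapping.rep_eq less_fun_def)

lemma pp_lessI:
  fixes s t :: "'k::linorder pp"
  assumes "Poly_Mapping.lookup s k < Poly_Mapping.lookup t k"
    "\<And>j. j < k \<Longrightarrow> Poly_Mapping.lookup s j = Poly_Mapping.lookup t j"
  shows "s < t"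
  using assms by (auto simp: less_poly_mapping.rep_eq less_fun_def)

text \<open>The comparison is decided at the least index of \<open>t\<close>: it is at most
  \<open>k\<close>, so \<open>s\<close> vanishes there, and both vanish below it.\<close>

lemma pp_less_if_smaller_key:
  fixes s t :: "'k::linorder pp"
  assumes "k \<in> Poly_Mapping.keys t" "\<And>j. j \<in> Poly_Mapping.keys s \<Longrightarrow> k < j"
  shows "s < t"
proof -
  let ?m = "Min (Poly_Mapping.keys t)"
  have ne: "Poly_Mapping.keys t \<noteq> {}"
    using assms(1) by blast
  have le: "?m \<le> k"
    using assms(1) by simp
  show ?thesis
  proof (rule pp_lessI)
    have "?m \<in> Poly_Mapping.keys t" "?m \<notin> Poly_Mapping.keys s"
      using ne assms(2) le by (auto simp: Min_in dest: leD)
    then show "Poly_Mapping.lookup s ?m < Poly_Mapping.lookup t ?m"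
      by (simp add: in_keys_iff)
    fix j assume j: "j < ?m"
    then have "j \<notin> Poly_Mapping.keys t"
      by (meson Min_le finite_keys leD)
    moreover have "j \<notin> Poly_Mapping.keys s"
      using assms(2) j le by (meson dual_order.strict_trans1 less_asym)
    ultimately show "Poly_Mapping.lookup s j = Poly_Mapping.lookup t j"
      by (simp add: in_keys_iff)
  qed
qed

subsection \<open>Quadratic exchanges\<close>

text \<open>The combinatorial setting: \<open>V\<close> and \<open>W\<close> are the variables of
  the two ambient rings, \<open>c\<close> is the collapse between them, \<open>\<kappa>\<close> the
  collapse of the underlying variables \<open>X\<close>, and \<open>eV\<close>, \<open>eW\<close>
  are the exponents of the parameterizing monomials. The assumption \<open>lift_var\<close> says
  that \<open>W\<close> comprises the whole preimage of \<open>V\<close>.\<close>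

locale monomial_lifting =
  fixes V :: "'v set" and W :: "'w set" and X :: "'x::linorder set"
    and \<kappa> :: "'x \<Rightarrow> 'y::linorder" and c :: "'w \<Rightarrow> 'v"
    and eV :: "'v \<Rightarrow> 'y pp" and eW :: "'w \<Rightarrow> 'x pp"
  assumes c_in: "w \<in> W \<Longrightarrow> c w \<in> V"
    and eW_in: "w \<in> W \<Longrightarrow> eW w \<in> pps X"
    and inj_eW: "inj_on eW W"
    and push_eW: "w \<in> W \<Longrightarrow> push \<kappa> (eW w) = eV (c w)"
    and lift_var: "v \<in> V \<Longrightarrow> M \<in> pps X \<Longrightarrow> push \<kappa> M = eV v \<Longrightarrow> \<exists>w\<in>W. c w = v \<and> eW w = M"
begin

abbreviation FV :: "'v pp \<Rightarrow> 'y pp" where "FV \<equiv> pp_extend eV"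
abbreviation FW :: "'w pp \<Rightarrow> 'x pp" where "FW \<equiv> pp_extend eW"

lemma push_c_in_pps: "t \<in> pps W \<Longrightarrow> push c t \<in> pps V"
  using c_in by (intro push_in_pps[of c W]) auto

lemma FW_in_pps: "t \<in> pps W \<Longrightarrow> FW t \<in> pps X"
  by (rule pp_extend_in_pps) (auto intro: eW_in)

lemma push_FW: "t \<in> pps W \<Longrightarrow> push \<kappa> (FW t) = FV (push c t)"
  unfolding push_pp_extend pp_extend_push
  by (rule pp_extend_cong_pps) (auto simp: push_eW)

text \<open>\<open>T\<close> is split along the factorization of \<open>b\<close> into variables,
  and \<open>lift_var\<close> turns each piece into a variable of \<open>W\<close>. Prescribing
  \<open>T\<close> along with \<open>b\<close> makes it possible to match a given image under
  \<open>FW\<close>.\<close>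

lemma lift_pp:
  assumes "b \<in> pps V" "T \<in> pps X" "push \<kappa> T = FV b"
  obtains b' where "b' \<in> pps W" "push c b' = b" "FW b' = T"
proof -
  have "\<exists>b'\<in>pps W. push c b' = b \<and> FW b' = T"
    using assms
  proof (induction b arbitrary: T rule: pps_induct)
    case zero
    then show ?case
      by (intro bexI[of _ 0]) auto
  next
    case (add v b)
    then obtain T1 T2 where T: "T = T1 + T2" "push \<kappa> T1 = eV v" "push \<kappa> T2 = FV b"
      by (auto elim: push_eq_add_split)
    then obtain b' where b': "b' \<in> pps W" "push c b' = b" "FW b' = T2"
      using add.IH[of T2] add.prems by auto
    obtain w where "w \<in> W" "c w = v" "eW w = T1"
      using lift_var[of v T1] T add by auto
    then show ?case
      using T b' by (intro bexI[of _ "pp_var w + b'"]) auto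
  qed
  with that show ?thesis
    by blast
qed

text \<open>The factor \<open>a\<close> of the collapse lifts to a factor \<open>a'\<close> of
  \<open>t\<close>. As \<open>a\<close> and \<open>b\<close> have equal images, \<open>FW a'\<close>
  is an admissible target for lifting \<open>b\<close>.\<close>

lemma lift_move:
  assumes "t \<in> pps W" "push c t = u + a" "b \<in> pps V" "FV a = FV b"
  obtains u' a' b' where "u' \<in> pps W" "a' \<in> pps W" "b' \<in> pps W" "t = u' + a'"
    "push c u' = u" "push c a' = a" "push c b' = b" "FW a' = FW b'"
proof -
  obtain u' a' where ua: "t = u' + a'" "push c u' = u" "push c a' = a"
    using assms(2) by (rule push_eq_add_split)
  then have in_W: "u' \<in> pps W" "a' \<in> pps W"
    using assms(1) by auto
  then have "push \<kappa> (FW a') = FV b"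
    using ua assms(4) by (simp add: push_FW)
  then obtain b' where "b' \<in> pps W" "push c b' = b" "FW b' = FW a'"
    using lift_pp[OF assms(3) FW_in_pps[OF in_W(2)]] by metis
  then show ?thesis
    using that ua in_W by metis
qed

text \<open>Pairs are compared lexicographically, so variables are ordered by their collapsed
  exponents first. Pushing along \<open>key\<close> carries power products over the unordered type
  of \<open>W\<close> to linearly ordered indices, where they can be compared.\<close>

definition key :: "'w \<Rightarrow> 'y pp \<times> 'x pp" where
  "key w = (push \<kappa> (eW w), eW w)"

lemma inj_on_key: "inj_on key W"
  using inj_eW by (auto simp: inj_on_def key_def)

text \<open>
  Let \<open>A\<close> and \<open>B\<close> be the variables of least key of \<open>s\<close> and \<open>t\<close> after
  cancelling common factors, so that \<open>A\<close> precedes \<open>B\<close>.  They have the same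
  collapse, because \<open>push c s = push c t\<close> and the collapse is the first component of the key.
  Moving towards \<open>A\<close> at the first index where \<open>A\<close> and \<open>B\<close> differ, by an exchange
  with another variable \<open>C\<close> of \<open>t\<close>, decreases the key of \<open>B\<close>.
\<close>

lemma quadratic_swap:
  assumes s: "s \<in> pps W" and t: "t \<in> pps W"
    and c_eq: "push c s = push c t" and F_eq: "FW s = FW t"
    and less: "push key t < push key s"
  obtains u q q' where "u \<in> pps W" "q \<in> pps W" "q' \<in> pps W" "t = u + q"
    "push c q = push c q'" "FW q = FW q'" "push key q < push key q'" "pp_degree q = 2"
proof -
  obtain g s' t' where g: "s = g + s'" "t = g + t'"
    "Poly_Mapping.keys s' \<inter> Poly_Mapping.keys t' = {}"
    by (rule pp_cancel_common)
  have in_W: "g \<in> pps W" "s' \<in> pps W" "t' \<in> pps W"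
    using s t g by auto
  have keys_W: "Poly_Mapping.keys s' \<subseteq> W" "Poly_Mapping.keys t' \<subseteq> W"
    using in_W by (auto simp: pps_def)
  have c': "push c s' = push c t'" and F': "FW s' = FW t'"
    and less': "push key t' < push key s'"
    using c_eq F_eq less g by auto
  \<comment> \<open>If one of them were zero, equality of the collapses would make the other zero
    too, against the strict inequality.\<close>
  have "s' \<noteq> 0" "t' \<noteq> 0"
    using less' c' push_pp_eq_zero_iff[of c s'] push_pp_eq_zero_iff[of c t'] by auto
  then have ne: "Poly_Mapping.keys s' \<noteq> {}" "Poly_Mapping.keys t' \<noteq> {}"
    by auto
  obtain A where A: "A \<in> Poly_Mapping.keys s'"
    and A_min: "\<And>w. w \<in> Poly_Mapping.keys s' \<Longrightarrow> key A \<le> key w"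
    using ex_is_arg_min_if_finite[OF finite_keys ne(1), of key]
    by (auto simp: is_arg_min_linorder)
  obtain B where B: "B \<in> Poly_Mapping.keys t'"
    and B_min: "\<And>w. w \<in> Poly_Mapping.keys t' \<Longrightarrow> key B \<le> key w"
    using ex_is_arg_min_if_finite[OF finite_keys ne(2), of key]
    by (auto simp: is_arg_min_linorder)
  have AB_W: "A \<in> W" "B \<in> W"
    using A B keys_W by auto
  have "key A \<noteq> key B"
    using AB_W A B g(3) inj_on_key by (auto dest: inj_onD)
  moreover have "\<not> key B < key A"
  proof
    \<comment> \<open>Then \<open>key B\<close> would lie below every key of \<open>s'\<close>,
      which reverses the inequality between \<open>s'\<close> and \<open>t'\<close>.\<close>
    assume BA: "key B < key A"
    have "push key s' < push key t'"
      by (rule pp_less_if_smaller_key[of "key B"]) (use B BA A_min in \<open>fastforce\<close>)+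
    with less' show False
      by simp
  qed
  ultimately have key_AB: "key A < key B"
    by simp
  have "c A \<in> c ` Poly_Mapping.keys t'"
    using A c' by (metis imageI keys_push_pp)
  then obtain B1 where B1: "B1 \<in> Poly_Mapping.keys t'" "c B1 = c A"
    by (metis imageE)
  \<comment> \<open>\<open>B1\<close> has the same collapsed exponent as \<open>A\<close>, and
    \<open>key A < key B \<le> key B1\<close>, so \<open>B\<close> has it too.\<close>
  have "key B \<le> key B1"
    by (rule B_min) fact
  moreover have "push \<kappa> (eW B1) = push \<kappa> (eW A)"
    using B1 AB_W keys_W by (auto simp: push_eW)
  ultimately have collapse: "push \<kappa> (eW A) = push \<kappa> (eW B)" and less_AB: "eW A < eW B"
    using key_AB by (auto simp: key_def less_prod_def less_eq_prod_def)
  obtain x where x: "Poly_Mapping.lookup (eW A) x < Poly_Mapping.lookup (eW B) x"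
    and x_min: "\<And>y. y < x \<Longrightarrow> Poly_Mapping.lookup (eW A) y = Poly_Mapping.lookup (eW B) y"
    using less_AB by (elim pp_lessE) (rule that, auto)
  \<comment> \<open>The collapses agree, so the deficit of \<open>A\<close> at \<open>x\<close> is
    balanced by a surplus at some \<open>y\<close> with the same collapse. As \<open>x\<close> is
    the first difference, \<open>y\<close> comes after \<open>x\<close>.\<close>
  obtain y where y: "\<kappa> y = \<kappa> x" "Poly_Mapping.lookup (eW B) y < Poly_Mapping.lookup (eW A) y"
    using push_eq_exponent_exchange[OF collapse x] by blast
  have "x \<noteq> y" "\<not> y < x"
    using x y x_min[of y] by auto
  then have "x < y"
    by simp
  obtain t'' where t'': "t' = pp_var B + t''"
    using B by (rule pp_remove_var)
  \<comment> \<open>\<open>B\<close> has a smaller exponent at \<open>y\<close> than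
    \<open>A\<close>, whereas the image of \<open>t'\<close> has at least that of \<open>A\<close>.
    Hence the rest \<open>t''\<close> involves \<open>y\<close>, which yields
    \<open>C\<close>.\<close>
  have "Poly_Mapping.lookup (eW A) y \<le> Poly_Mapping.lookup (FW t') y"
    using lookup_le_pp_extend[OF A, of eW y] F' by simp
  then have "y \<in> Poly_Mapping.keys (FW t'')"
    using y(2) t'' by (auto simp: in_keys_iff lookup_add)
  then obtain C where C: "C \<in> Poly_Mapping.keys t''" "y \<in> Poly_Mapping.keys (eW C)"
    by (rule in_keys_pp_extendE)
  obtain u where u: "t'' = pp_var C + u"
    using C(1) by (rule pp_remove_var)
  have CW: "C \<in> W" "u \<in> pps W"
    using in_W t'' u by auto
  have "x \<in> Poly_Mapping.keys (eW B)"
    using x by (auto simp: in_keys_iff)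
  then obtain \<beta> where \<beta>: "eW B = pp_var x + \<beta>"
    by (rule pp_remove_var)
  obtain \<gamma> where \<gamma>: "eW C = pp_var y + \<gamma>"
    using C(2) by (rule pp_remove_var)
  have X: "pp_var x + \<beta> \<in> pps X" "pp_var y + \<gamma> \<in> pps X"
    using eW_in AB_W CW \<beta> \<gamma> by metis+
  \<comment> \<open>Exchanging \<open>x\<close> and \<open>y\<close> between \<open>B\<close> and
    \<open>C\<close> changes neither collapse, because
    \<open>\<kappa> y = \<kappa> x\<close>.\<close>
  have K: "push \<kappa> (pp_var y + \<beta>) = push \<kappa> (eW B)" "push \<kappa> (pp_var x + \<gamma>) = push \<kappa> (eW C)"
    using y(1) \<beta> \<gamma> by auto
  obtain B' where B': "B' \<in> W" "c B' = c B" "eW B' = pp_var y + \<beta>"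
    using lift_var[of "c B" "pp_var y + \<beta>"] X K AB_W by (auto simp: c_in push_eW)
  obtain C' where C': "C' \<in> W" "c C' = c C" "eW C' = pp_var x + \<gamma>"
    using lift_var[of "c C" "pp_var x + \<gamma>"] X K CW by (auto simp: c_in push_eW)
  have "eW B' < eW B"
    unfolding B' \<beta> using \<open>x < y\<close> by (intro pp_lessI[of _ x]) (auto simp: lookup_add lookup_pp_var)
  then have key_B': "key B' < key B"
    using B'(3) K(1) by (auto simp: key_def less_prod_def)
  have "key B \<le> key C"
    using B_min[of C] t'' C(1) by simp
  \<comment> \<open>\<open>B'\<close> has a smaller key than both \<open>B\<close> and
    \<open>C\<close>, so the new pair is larger whatever the key of \<open>C'\<close>.\<close>
  have "push key (pp_var B + pp_var C) < push key (pp_var B' + pp_var C')"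
    by (rule pp_less_if_smaller_key[of "key B'"])
      (use key_B' \<open>key B \<le> key C\<close> in \<open>auto intro: less_le_trans\<close>)
  then show ?thesis
  proof (rule that[rotated 6])
    show "g + u \<in> pps W" "pp_var B + pp_var C \<in> pps W" "pp_var B' + pp_var C' \<in> pps W"
      using in_W CW AB_W B' C' by auto
    show "t = g + u + (pp_var B + pp_var C)"
      using g t'' u by (simp add: add_ac)
    show "push c (pp_var B + pp_var C) = push c (pp_var B' + pp_var C')"
      using B' C' by simp
    show "FW (pp_var B + pp_var C) = FW (pp_var B' + pp_var C')"
      using B' C' \<beta> \<gamma> by (simp add: add_ac)
  qed simp
qed

end

subsection \<open>Binomial spans as kernels\<close>

text \<open>The coefficient at \<open>F t\<close> of the pushforward sums the coefficients over a
  fibre. Were \<open>t\<close> the only term there, it would be the nonzero coefficient of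
  \<open>t\<close>.\<close>

lemma push_eq_zero_partner:
  assumes "push F p = 0" "t \<in> Poly_Mapping.keys p"
  obtains s where "s \<in> Poly_Mapping.keys p" "s \<noteq> t" "F s = F t"
proof (rule ccontr)
  note partner = that
  assume "\<not> thesis"
  then have none: "F s = F t \<Longrightarrow> s = t" if "s \<in> Poly_Mapping.keys p" for s
    using partner that by blast
  have "(Poly_Mapping.lookup p k when F k = F t) = (Poly_Mapping.lookup p k when k = t)"
    if "k \<in> Poly_Mapping.keys p" for k
    using none[OF that] by (auto simp: when_def)
  then have "Poly_Mapping.lookup (push F p) (F t) = Poly_Mapping.lookup p t"
    using assms(2) by (simp add: lookup_push when_def)
  with assms show False
    by (simp add: in_keys_iff)
qed

text \<open>Subtracting a multiple of the binomial on \<open>t\<close> and a partner removes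
  \<open>t\<close> from the support and adds nothing new. All binomials stay within the support of
  \<open>p\<close>, so degree bounds on the terms of \<open>p\<close> carry over to them.\<close>

lemma push_eq_zero_induct [consumes 1, case_names zero binomial]:
  fixes p :: "'k \<Rightarrow>\<^sub>0 'c::ab_group_add"
  assumes "push F p = 0" and "P 0"
    and "\<And>c s t q. \<lbrakk>s \<in> Poly_Mapping.keys p; t \<in> Poly_Mapping.keys p; F s = F t; P q\<rbrakk>
      \<Longrightarrow> P ((Poly_Mapping.single t c - Poly_Mapping.single s c) + q)"
  shows "P p"
proof -
  have "P q" if "push F q = 0" "Poly_Mapping.keys q \<subseteq> Poly_Mapping.keys p" for q
    using that
  proof (induction "card (Poly_Mapping.keys q)" arbitrary: q rule: less_induct)
    case less
    show ?case
    proof (cases "q = 0")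
      case False
      then obtain t where t: "t \<in> Poly_Mapping.keys q"
        by fastforce
      obtain s where s: "s \<in> Poly_Mapping.keys q" "s \<noteq> t" "F s = F t"
        using push_eq_zero_partner[OF less.prems(1) t] .
      let ?b = "Poly_Mapping.single t (Poly_Mapping.lookup q t) -
        Poly_Mapping.single s (Poly_Mapping.lookup q t)"
      have keys: "Poly_Mapping.keys (q - ?b) \<subseteq> Poly_Mapping.keys q - {t}"
        using s t by (auto simp: in_keys_iff lookup_minus lookup_single when_def split: if_splits)
      then have "card (Poly_Mapping.keys (q - ?b)) < card (Poly_Mapping.keys q)"
        using t by (intro psubset_card_mono) auto
      moreover have "push F (q - ?b) = 0"
        using less.prems(1) s(3) by simp
      ultimately have "P (q - ?b)"
        using less.hyps less.prems(2) keys by blast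
      then have "P (?b + (q - ?b))"
        using assms(3) s t less.prems(2) by blast
      then show ?thesis
        by simp
    qed (simp add: assms(2))
  qed
  with assms(1) show ?thesis
    by blast
qed

lemma sum_single_lookup: "(\<Sum>t\<in>Poly_Mapping.keys p. Poly_Mapping.single t (Poly_Mapping.lookup p t)) = p"
  by (intro poly_mapping_eqI) (simp add: lookup_sum lookup_single when_def in_keys_iff)

section \<open>Ideals of the polynomial ring\<close>

lemma carrier_mpoly_ring: "p \<in> carrier (mpoly_ring V) \<longleftrightarrow> Poly_Mapping.keys p \<subseteq> pps V"
  by (simp add: mpoly_ring_def)

lemma mpoly_ring_simps [simp]:
  "p \<otimes>\<^bsub>mpoly_ring V\<^esub> q = p * q" "p \<oplus>\<^bsub>mpoly_ring V\<^esub> q = p + q"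
  "\<zero>\<^bsub>mpoly_ring V\<^esub> = 0" "\<one>\<^bsub>mpoly_ring V\<^esub> = 1"
  by (simp_all add: mpoly_ring_def)

lemma single_in_mpoly_ring: "t \<in> pps V \<Longrightarrow> Poly_Mapping.single t c \<in> carrier (mpoly_ring V)"
  by (simp add: carrier_mpoly_ring)

text \<open>A polynomial is the sum of its terms, so closure under multiplication by single terms
  suffices; the constant \<open>- 1\<close> provides negatives.\<close>

lemma mpoly_idealI:
  fixes I :: "('v, 'a::comm_ring_1) mpoly set"
  assumes carr: "I \<subseteq> carrier (mpoly_ring V)" and zero: "0 \<in> I"
    and add: "\<And>p q. p \<in> I \<Longrightarrow> q \<in> I \<Longrightarrow> p + q \<in> I"
    and mult: "\<And>u c p. u \<in> pps V \<Longrightarrow> p \<in> I \<Longrightarrow> Poly_Mapping.single u c * p \<in> I"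
  shows "ideal I (mpoly_ring V)"
proof -
  interpret cring "mpoly_ring V :: ('v, 'a) mpoly ring"
    by (rule cring_mpoly_ring)
  have sum: "sum f S \<in> I" if "\<And>x. x \<in> S \<Longrightarrow> f x \<in> I" for f :: "'v pp \<Rightarrow> ('v, 'a) mpoly" and S
    using that by (induction S rule: infinite_finite_induct) (auto simp: zero add)
  have l_closed: "x * p \<in> I" if "p \<in> I" "x \<in> carrier (mpoly_ring V)" for p x
  proof -
    have "(\<Sum>t\<in>Poly_Mapping.keys x. Poly_Mapping.single t (Poly_Mapping.lookup x t) * p) \<in> I"
      using that by (intro sum mult) (auto simp: carrier_mpoly_ring)
    then show ?thesis
      by (simp add: sum_single_lookup flip: sum_distrib_right)
  qed
  have neg: "- p \<in> I" if "p \<in> I" for p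
    using mult[OF zero_in_pps that, of "- 1"] by (simp add: single_uminus)
  show ?thesis
  proof (rule idealI)
    show "subgroup I (add_monoid (mpoly_ring V))"
    proof (rule add.subgroupI)
      show "\<ominus>\<^bsub>mpoly_ring V\<^esub> p \<in> I" if "p \<in> I" for p
      proof -
        have "\<ominus>\<^bsub>mpoly_ring V\<^esub> p = - p"
          using that neg carr by (intro minus_equality) auto
        with neg[OF that] show ?thesis
          by simp
      qed
    qed (use carr zero add in auto)
  qed (use l_closed in \<open>auto simp: ring_axioms mult.commute\<close>)
qed

context
  fixes V :: "'v set" and G :: "('v, 'a::comm_ring_1) mpoly set"
  assumes G: "G \<subseteq> carrier (mpoly_ring V)"
begin

interpretation cring "mpoly_ring V :: ('v, 'a) mpoly ring"
  by (rule cring_mpoly_ring)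

interpretation I: ideal "Idl\<^bsub>mpoly_ring V\<^esub> G" "mpoly_ring V"
  by (rule genideal_ideal[OF G])

lemma Idl_superset: "p \<in> G \<Longrightarrow> p \<in> Idl\<^bsub>mpoly_ring V\<^esub> G"
  using genideal_self[OF G] by blast

lemma Idl_zero: "0 \<in> Idl\<^bsub>mpoly_ring V\<^esub> G"
  using I.zero_closed by simp

lemma Idl_add: "p \<in> Idl\<^bsub>mpoly_ring V\<^esub> G \<Longrightarrow> q \<in> Idl\<^bsub>mpoly_ring V\<^esub> G \<Longrightarrow> p + q \<in> Idl\<^bsub>mpoly_ring V\<^esub> G"
  using I.a_closed[of p q] by simp

lemma Idl_mult_single:
  "u \<in> pps V \<Longrightarrow> p \<in> Idl\<^bsub>mpoly_ring V\<^esub> G \<Longrightarrow> Poly_Mapping.single u c * p \<in> Idl\<^bsub>mpoly_ring V\<^esub> G"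
  using I.I_l_closed[of p "Poly_Mapping.single u c"] by (simp add: single_in_mpoly_ring)

lemma Idl_least:
  "ideal I (mpoly_ring V) \<Longrightarrow> G \<subseteq> I \<Longrightarrow> Idl\<^bsub>mpoly_ring V\<^esub> G \<subseteq> I"
  by (rule genideal_minimal)

end

text \<open>The polynomials supported on multiples of members of \<open>T\<close> form an ideal
  containing the generators, so membership of a monomial becomes divisibility.\<close>

lemma power_monomial_in_monomial_ideal_iff:
  assumes T: "T \<subseteq> pps V" and t: "t \<in> pps V"
  shows "(power_monomial t :: ('v, 'a::comm_ring_1) mpoly) \<in> Idl\<^bsub>mpoly_ring V\<^esub> (power_monomial ` T)
    \<longleftrightarrow> (\<exists>s\<in>T. \<exists>u\<in>pps V. t = u + s)"
proof
  let ?G = "power_monomial ` T :: ('v, 'a) mpoly set"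
  have G: "?G \<subseteq> carrier (mpoly_ring V)"
    using T by (auto simp: power_monomial_def single_in_mpoly_ring)
  {
    assume "(power_monomial t :: ('v, 'a) mpoly) \<in> Idl\<^bsub>mpoly_ring V\<^esub> ?G"
    let ?M = "{u + s |u s. u \<in> pps V \<and> s \<in> T}"
    let ?I = "{p :: ('v, 'a) mpoly. Poly_Mapping.keys p \<subseteq> ?M}"
    have "ideal ?I (mpoly_ring V)"
    proof (rule mpoly_idealI)
      show "?I \<subseteq> carrier (mpoly_ring V)"
        using T by (fastforce simp: carrier_mpoly_ring)
      show "p + q \<in> ?I" if "p \<in> ?I" "q \<in> ?I" for p q
        using that Poly_Mapping.keys_add[of p q] by blast
      show "Poly_Mapping.single u c * p \<in> ?I" if "u \<in> pps V" "p \<in> ?I" for u c p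
      proof -
        have "Poly_Mapping.keys (Poly_Mapping.single u c * p) \<subseteq> {u + m |m. m \<in> ?M}"
          using keys_mult[of "Poly_Mapping.single u c" p] that(2) by (fastforce split: if_splits)
        also have "\<dots> \<subseteq> ?M"
          using that(1) by (fastforce simp flip: add.assoc)
        finally show ?thesis
          by simp
      qed
    qed auto
    moreover have "?G \<subseteq> ?I"
      by (force simp: power_monomial_def)
    ultimately have "Idl\<^bsub>mpoly_ring V\<^esub> ?G \<subseteq> ?I"
      by (rule Idl_least[OF G])
    with \<open>power_monomial t \<in> _\<close> show "\<exists>s\<in>T. \<exists>u\<in>pps V. t = u + s"
      by (force simp: power_monomial_def)
  next
    assume "\<exists>s\<in>T. \<exists>u\<in>pps V. t = u + s"
    then obtain s u where "s \<in> T" "u \<in> pps V" "t = u + s"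
      by blast
    then show "(power_monomial t :: ('v, 'a) mpoly) \<in> Idl\<^bsub>mpoly_ring V\<^esub> ?G"
      using Idl_mult_single[OF G _ Idl_superset[OF G, of "power_monomial s"], of u 1]
      by (simp add: power_monomial_def mult_single)
  }
qed

section \<open>Kernels of linearly extended maps of power products\<close>

definition toric :: "'v set \<Rightarrow> ('v pp \<Rightarrow> 'b) \<Rightarrow> ('v, 'a::comm_ring_1) mpoly set" where
  "toric V F = {p. Poly_Mapping.keys p \<subseteq> pps V \<and> push F p = 0}"

definition unit_binomial :: "'k \<Rightarrow> 'k \<Rightarrow> ('k \<Rightarrow>\<^sub>0 'a::comm_ring_1)" where
  "unit_binomial t s = Poly_Mapping.single t 1 - Poly_Mapping.single s 1"

lemma keys_unit_binomial:
  "s \<noteq> t \<Longrightarrow> Poly_Mapping.keys (unit_binomial t s :: _ \<Rightarrow>\<^sub>0 'a::comm_ring_1) = {t, s}"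
  by (auto simp: unit_binomial_def in_keys_iff lookup_minus lookup_single when_def split: if_splits)

lemma unit_binomial_self [simp]: "unit_binomial t t = 0"
  by (simp add: unit_binomial_def)

lemma single_mult_unit_binomial:
  "Poly_Mapping.single u c * unit_binomial t s =
    Poly_Mapping.single (u + t) c - Poly_Mapping.single (u + s) c"
  by (simp add: unit_binomial_def mult_single right_diff_distrib)

lemma unit_binomial_in_toric_iff:
  assumes "s \<in> pps V" "t \<in> pps V"
  shows "(unit_binomial t s :: ('v, 'a::comm_ring_1) mpoly) \<in> toric V F \<longleftrightarrow> F t = F s"
proof -
  have "Poly_Mapping.keys (unit_binomial t s :: ('v, 'a) mpoly) \<subseteq> pps V"
    using assms by (cases "s = t") (auto simp: keys_unit_binomial)
  moreover have "push F (unit_binomial t s :: ('v, 'a) mpoly) = unit_binomial (F t) (F s)"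
    by (simp add: unit_binomial_def)
  moreover have "(unit_binomial (F t) (F s) :: _ \<Rightarrow>\<^sub>0 'a) = 0 \<longleftrightarrow> F t = F s"
    by (metis insert_not_empty keys_unit_binomial keys_zero unit_binomial_self)
  ultimately show ?thesis
    by (simp add: toric_def)
qed

text \<open>\<open>F\<close> may be any map whose fibres are compatible with multiplication; below
  it is also used for the classes of an equivalence relation. The kernel is spanned by binomials
  with equal images, and a multiple of such a binomial is again one.\<close>

lemma ideal_toric:
  assumes cong: "\<And>s t u. \<lbrakk>s \<in> pps V; t \<in> pps V; u \<in> pps V; F s = F t\<rbrakk> \<Longrightarrow> F (u + s) = F (u + t)"
  shows "ideal (toric V F :: ('v, 'a::comm_ring_1) mpoly set) (mpoly_ring V)"
proof (rule mpoly_idealI)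
  show "p + q \<in> toric V F" if "p \<in> toric V F" "q \<in> toric V F" for p q :: "('v, 'a) mpoly"
    using that Poly_Mapping.keys_add[of p q] by (auto simp: toric_def)
  show "Poly_Mapping.single u c * p \<in> toric V F" if u: "u \<in> pps V" and p: "p \<in> toric V F"
    for u c and p :: "('v, 'a) mpoly"
  proof -
    have "Poly_Mapping.keys (Poly_Mapping.single u c * p) \<subseteq> pps V"
      using u p keys_mult[of "Poly_Mapping.single u c" p]
      by (fastforce simp: toric_def split: if_splits)
    moreover have "push F p = 0"
      using p by (simp add: toric_def)
    then have "push F (Poly_Mapping.single u c * p) = 0"
    proof (induction rule: push_eq_zero_induct)
      case (binomial b s t q)
      then have "F (u + s) = F (u + t)"
        using p u by (intro cong) (auto simp: toric_def)
      then show ?case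
        using binomial.IH by (simp add: distrib_left right_diff_distrib mult_single)
    qed simp
    ultimately show ?thesis
      by (simp add: toric_def)
  qed
qed (auto simp: toric_def carrier_mpoly_ring)

subsection \<open>Leading power products\<close>

lemma leading_pp_eqI:
  assumes "term_order V r" "t \<in> Poly_Mapping.keys p" "\<And>s. s \<in> Poly_Mapping.keys p \<Longrightarrow> (s, t) \<in> r"
  shows "leading_pp r p = t"
  unfolding leading_pp_def
proof (rule the_equality)
  have "antisym r"
    using assms(1) by (auto simp: term_order_def order_on_defs)
  then show "t' = t" if "t' \<in> Poly_Mapping.keys p \<and> (\<forall>s\<in>Poly_Mapping.keys p. (s, t') \<in> r)" for t'
    using that assms by (meson antisymD)
qed (use assms in auto)

lemma linear_order_on_finite_has_max:
  assumes "linear_order_on A r" "finite S" "S \<noteq> {}" "S \<subseteq> A"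
  obtains m where "m \<in> S" "\<And>s. s \<in> S \<Longrightarrow> (s, m) \<in> r"
proof -
  have "\<exists>m\<in>S. \<forall>s\<in>S. (s, m) \<in> r"
    using assms(2-4)
  proof (induction S rule: finite_ne_induct)
    case (singleton x)
    then show ?case
      using assms(1) by (auto simp: order_on_defs refl_on_def)
  next
    case (insert x S)
    then obtain m where m: "m \<in> S" "\<forall>s\<in>S. (s, m) \<in> r"
      by auto
    have x: "(x, x) \<in> r"
      using insert assms(1) by (auto simp: order_on_defs refl_on_def)
    have "(x, m) \<in> r \<or> (m, x) \<in> r"
      using insert m assms(1) x by (auto simp: order_on_defs total_on_def)
    then show ?case
    proof
      assume "(m, x) \<in> r"
      then have "\<forall>s\<in>S. (s, x) \<in> r"
        using m assms(1) by (auto simp: order_on_defs dest: transD)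
      with x show ?thesis
        by blast
    qed (use m in blast)
  qed
  with that show ?thesis
    by blast
qed

lemma leading_pp_is_max:
  assumes "term_order V r" "p \<noteq> 0" "Poly_Mapping.keys p \<subseteq> pps V"
  shows "leading_pp r p \<in> Poly_Mapping.keys p"
    and "s \<in> Poly_Mapping.keys p \<Longrightarrow> (s, leading_pp r p) \<in> r"
proof -
  have "linear_order_on (pps V) r" "Poly_Mapping.keys p \<noteq> {}"
    using assms by (auto simp: term_order_def)
  then obtain m where m: "m \<in> Poly_Mapping.keys p" "\<And>s. s \<in> Poly_Mapping.keys p \<Longrightarrow> (s, m) \<in> r"
    using linear_order_on_finite_has_max[OF _ finite_keys _ assms(3)] by metis
  then have "leading_pp r p = m"
    by (intro leading_pp_eqI[OF assms(1)])
  with m show "leading_pp r p \<in> Poly_Mapping.keys p"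
    "s \<in> Poly_Mapping.keys p \<Longrightarrow> (s, leading_pp r p) \<in> r"
    by auto
qed

text \<open>Reduces the comparison of initial ideals to divisibility by leading power
  products.\<close>

lemma power_monomial_in_initial_ideal_iff:
  fixes F :: "('v, 'a::comm_ring_1) mpoly set"
  assumes "term_order V r" "F \<subseteq> carrier (mpoly_ring V)" "t \<in> pps V"
  shows "(power_monomial t :: ('v, 'a) mpoly) \<in> initial_ideal V r F \<longleftrightarrow>
    (\<exists>p\<in>F - {0}. \<exists>u\<in>pps V. t = u + leading_pp r p)"
proof -
  have "leading_pp r ` (F - {0}) \<subseteq> pps V"
    using assms leading_pp_is_max(1)[OF assms(1)] by (fastforce simp: carrier_mpoly_ring)
  from power_monomial_in_monomial_ideal_iff[OF this assms(3), where 'a = 'a] show ?thesis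
    by (auto simp: initial_ideal_def image_image)
qed

subsection \<open>Lifting generators and Groebner bases\<close>

locale graded_monomial_lifting = monomial_lifting V W X \<kappa> c eV eW
  for V :: "'v set" and W :: "'w set" and X :: "'x::linorder set"
    and \<kappa> :: "'x \<Rightarrow> 'y::linorder" and c :: "'w \<Rightarrow> 'v"
    and eV :: "'v \<Rightarrow> 'y pp" and eW :: "'w \<Rightarrow> 'x pp" +
  fixes d :: nat
  assumes finite_W: "finite W" and d_pos: "d > 0"
    and degree_eV: "v \<in> V \<Longrightarrow> pp_degree (eV v) = d"
begin

text \<open>\<open>FV\<close> multiplies degrees by \<open>d\<close>, which is positive. Hence a
  degree bound on one term of a binomial bounds both.\<close>

lemma degree_eq_if_FV_eq:
  assumes "s \<in> pps V" "t \<in> pps V" "FV s = FV t"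
  shows "pp_degree s = pp_degree t"
proof -
  have "pp_degree (FV s) = d * pp_degree s" "pp_degree (FV t) = d * pp_degree t"
    using assms(1,2) degree_eV pp_degree_pp_extend[of V eV d] by blast+
  then show ?thesis
    using assms(3) d_pos by simp
qed

lemma FV_push_eq_if_FW_eq:
  "s \<in> pps W \<Longrightarrow> t \<in> pps W \<Longrightarrow> FW s = FW t \<Longrightarrow> FV (push c s) = FV (push c t)"
  by (simp flip: push_FW)

lemma degree_eq_if_FW_eq:
  assumes "s \<in> pps W" "t \<in> pps W" "FW s = FW t"
  shows "pp_degree s = pp_degree t"
  using degree_eq_if_FV_eq[OF push_c_in_pps[OF assms(1)] push_c_in_pps[OF assms(2)]
    FV_push_eq_if_FW_eq[OF assms]] by simp

lemma ideal_toric_FW: "ideal (toric W FW :: ('w, 'a::comm_ring_1) mpoly set) (mpoly_ring W)"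
  by (rule ideal_toric) simp

lemma push_key_eq_iff:
  "s \<in> pps W \<Longrightarrow> t \<in> pps W \<Longrightarrow> push key s = push key t \<longleftrightarrow> s = t"
  using inj_on_push[OF inj_on_key] by (auto dest: inj_onD)

text \<open>One set for two purposes: it generates the ideal in the first theorem below and is the
  Groebner basis in the second.\<close>

definition binomials_le :: "int \<Rightarrow> ('w, 'a::comm_ring_1) mpoly set" where
  "binomials_le k = {unit_binomial t s |s t. s \<in> pps W \<and> t \<in> pps W \<and> s \<noteq> t \<and> FW s = FW t \<and>
    int (pp_degree t) \<le> k}"

lemma binomials_le_subset: "binomials_le k \<subseteq> toric W FW"
  by (auto simp: binomials_le_def unit_binomial_in_toric_iff)

lemma toric_subset_carrier: "toric U F \<subseteq> carrier (mpoly_ring U)"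
  by (auto simp: toric_def carrier_mpoly_ring)

lemma degree_keys_binomials_le:
  assumes "g \<in> binomials_le k"
  obtains e where "int e \<le> k" "homogeneous_of_degree e g" "binomial g"
proof -
  obtain s t where g: "g = unit_binomial t s" "s \<noteq> t" "int (pp_degree t) \<le> k"
    and "s \<in> pps W" "t \<in> pps W" "FW s = FW t"
    using assms by (auto simp: binomials_le_def)
  then have "pp_degree s = pp_degree t"
    by (intro degree_eq_if_FW_eq)
  with g show ?thesis
    by (intro that[of "pp_degree t"])
      (auto simp: homogeneous_of_degree_def binomial_def keys_unit_binomial)
qed

text \<open>Generation is translated into connectedness of the fibres of \<open>FV\<close> under
  moves of degree at most \<open>k\<close>; paths are lifted, and the result is translated
  back.\<close>

theorem generated_in_degrees_le_lift:
  assumes gen: "generated_in_degrees_le V k (toric V FV :: ('v, 'a::comm_ring_1) mpoly set)"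
    and k: "k \<ge> 2"
  shows "generated_in_degrees_le W k (toric W FW :: ('w, 'a) mpoly set)"
proof -
  let ?B = "binomials_le k :: ('w, 'a) mpoly set"
  let ?I = "Idl\<^bsub>mpoly_ring W\<^esub> ?B"
  have B: "?B \<subseteq> carrier (mpoly_ring W)"
    using binomials_le_subset toric_subset_carrier by blast
  define eqv where "eqv t s \<longleftrightarrow> unit_binomial t s \<in> ?I" for t s
  have eqv_refl: "eqv t t" for t
    using Idl_zero[OF B] by (simp add: eqv_def)
  have eqv_trans: "eqv r t" if "eqv r s" "eqv s t" for r s t
    using Idl_add[OF B, of "unit_binomial r s" "unit_binomial s t"] that
    by (simp add: eqv_def unit_binomial_def)
  have eqv_sym: "eqv s t" if "eqv t s" for s t
    using Idl_mult_single[OF B zero_in_pps, of "unit_binomial t s" "- 1"] that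
    by (simp add: eqv_def single_mult_unit_binomial single_uminus unit_binomial_def)
  have eqv_move: "eqv (u + a) (u + b)" if "u \<in> pps W" "a \<in> pps W" "b \<in> pps W" "FW a = FW b"
    "int (pp_degree a) \<le> k" for u a b
  proof (cases "a = b")
    case False
    with that have "unit_binomial a b \<in> ?B"
      by (fastforce simp: binomials_le_def)
    from Idl_mult_single[OF B that(1) Idl_superset[OF B this], of 1] show ?thesis
      unfolding eqv_def single_mult_unit_binomial by (simp add: unit_binomial_def)
  qed (simp add: eqv_refl)

  have swap: "eqv s t" if t: "t \<in> pps W" and s: "s \<in> pps W"
    and c_eq: "push c s = push c t" and F_eq: "FW s = FW t" for s t
  proof -
    \<comment> \<open>The power products with the collapse and the image of \<open>t\<close>. They
      have the degree of \<open>t\<close>, so they are finitely many. Swaps that increase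
      \<open>push key\<close> join each of them to the greatest one, \<open>m\<close>, and hence to
      each other.\<close>
    define \<Phi> where "\<Phi> = {r \<in> pps W. push c r = push c t \<and> FW r = FW t}"
    have "\<Phi> \<subseteq> {r \<in> pps W. pp_degree r \<le> pp_degree t}"
      using degree_eq_if_FW_eq[OF _ t] by (auto simp: \<Phi>_def)
    then have fin: "finite \<Phi>"
      by (rule finite_subset) (rule finite_pps_degree_le[OF finite_W])
    have "\<Phi> \<noteq> {}"
      using t by (auto simp: \<Phi>_def)
    then have "Max (push key ` \<Phi>) \<in> push key ` \<Phi>"
      using fin by (intro Max_in) auto
    then obtain m where m: "m \<in> \<Phi>" "push key m = Max (push key ` \<Phi>)"
      by (metis imageE)
    have m_max: "push key r \<le> push key m" if "r \<in> \<Phi>" for r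
      unfolding m(2) using fin that by (intro Max_ge) auto
    have to_m: "eqv r m" if "r \<in> \<Phi>" for r
      using that
    proof (induction "card {r' \<in> \<Phi>. push key r < push key r'}" arbitrary: r rule: less_induct)
      case less
      show ?case
      proof (cases "r = m")
        case False
        then have less_m: "push key r < push key m"
          using m_max[OF less.prems] push_key_eq_iff[of r m] m(1) less.prems
          by (auto simp: \<Phi>_def)
        have m_in: "m \<in> pps W" "push c m = push c t" "FW m = FW t"
          and r_in: "r \<in> pps W" "push c r = push c t" "FW r = FW t"
          using m(1) less.prems by (auto simp: \<Phi>_def)
        have c_eq: "push c m = push c r" and F_eq: "FW m = FW r"
          using m_in r_in by simp_all
        obtain u q q' where uq: "u \<in> pps W" "q \<in> pps W" "q' \<in> pps W" "r = u + q"
          "push c q = push c q'" "FW q = FW q'" "push key q < push key q'" "pp_degree q = 2"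
          using quadratic_swap[OF m_in(1) r_in(1) c_eq F_eq less_m] .
        have "push c (u + q') = push c r" "FW (u + q') = FW r"
          unfolding uq(4) by (simp_all add: uq(5,6))
        then have in_\<Phi>: "u + q' \<in> \<Phi>"
          unfolding \<Phi>_def using r_in uq(1,3) by simp
        have less_uq': "push key r < push key (u + q')"
          unfolding uq(4) using uq(7) by simp
        have "{r' \<in> \<Phi>. push key (u + q') < push key r'} \<subset> {r' \<in> \<Phi>. push key r < push key r'}"
        proof
          show "{r' \<in> \<Phi>. push key (u + q') < push key r'} \<subseteq> {r' \<in> \<Phi>. push key r < push key r'}"
            using less_trans[OF less_uq'] by blast
          show "{r' \<in> \<Phi>. push key (u + q') < push key r'} \<noteq> {r' \<in> \<Phi>. push key r < push key r'}"
            using in_\<Phi> less_uq' by blast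
        qed
        then have "card {r' \<in> \<Phi>. push key (u + q') < push key r'} <
            card {r' \<in> \<Phi>. push key r < push key r'}"
          using fin by (intro psubset_card_mono) auto
        then have "eqv (u + q') m"
          using less.hyps in_\<Phi> by blast
        moreover have "eqv r (u + q')"
          unfolding uq(4) using uq k by (intro eqv_move) auto
        ultimately show ?thesis
          using eqv_trans by blast
      qed (simp add: eqv_refl)
    qed
    have "s \<in> \<Phi>" "t \<in> \<Phi>"
      using s t c_eq F_eq by (auto simp: \<Phi>_def)
    then show ?thesis
      using to_m eqv_sym eqv_trans by blast
  qed

  define R where "R s t \<longleftrightarrow> (\<exists>u a b. u \<in> pps V \<and> a \<in> pps V \<and> b \<in> pps V \<and> s = u + a \<and>
    t = u + b \<and> FV a = FV b \<and> int (pp_degree a) \<le> k)" for s t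
  have R_sym: "R t s" if "R s t" for s t
    using that degree_eq_if_FV_eq unfolding R_def by metis
  \<comment> \<open>\<open>F'\<close> sends a power product to its connected component under moves.
    Its toric ideal contains the generators \<open>G\<close>, hence the whole ideal of
    \<open>FV\<close>, so equal images under \<open>FV\<close> force equal components.\<close>
  define F' where "F' t = {s. R\<^sup>*\<^sup>* t s}" for t
  have "symp R"
    using R_sym by (rule sympI)
  have F'_eq_iff: "F' s = F' t \<longleftrightarrow> R\<^sup>*\<^sup>* s t" for s t
  proof
    assume "R\<^sup>*\<^sup>* s t"
    moreover from this have "R\<^sup>*\<^sup>* t s"
      using \<open>symp R\<close> by (metis sympD symp_rtranclp)
    ultimately show "F' s = F' t"
      unfolding F'_def by (auto intro: rtranclp_trans)
  qed (auto simp: F'_def)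
  have R_cong: "R (u + s) (u + t)" if "u \<in> pps V" "R s t" for u s t
  proof -
    obtain v a b where "v \<in> pps V" "a \<in> pps V" "b \<in> pps V" "s = v + a" "t = v + b"
      "FV a = FV b" "int (pp_degree a) \<le> k"
      using \<open>R s t\<close> unfolding R_def by blast
    with that(1) show ?thesis
      unfolding R_def
      by (intro exI[of _ "u + v"] exI[of _ a] exI[of _ b]) (simp add: add.assoc)
  qed
  have "R\<^sup>*\<^sup>* (u + s) (u + t)" if "u \<in> pps V" "R\<^sup>*\<^sup>* s t" for u s t
    using that(2) by (induction rule: rtranclp_induct)
      (auto intro: R_cong[OF that(1)] rtranclp.rtrancl_into_rtrancl)
  then have ideal_F': "ideal (toric V F' :: ('v, 'a) mpoly set) (mpoly_ring V)"
    by (intro ideal_toric) (simp add: F'_eq_iff)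
  obtain G :: "('v, 'a) mpoly set" where G: "G \<subseteq> carrier (mpoly_ring V)"
    and G_hom: "\<And>g. g \<in> G \<Longrightarrow> \<exists>e. int e \<le> k \<and> homogeneous_of_degree e g"
    and G_gen: "toric V FV = Idl\<^bsub>mpoly_ring V\<^esub> G"
    using gen unfolding generated_in_degrees_le_def by blast
  have "G \<subseteq> toric V F'"
  proof
    fix g assume g: "g \<in> G"
    then obtain e where e: "int e \<le> k" "homogeneous_of_degree e g"
      using G_hom by blast
    have keys: "Poly_Mapping.keys g \<subseteq> pps V"
      using subsetD[OF G g] by (simp add: carrier_mpoly_ring)
    have "g \<in> toric V FV"
      unfolding G_gen using g by (rule Idl_superset[OF G])
    then have "push FV g = 0"
      by (simp add: toric_def)
    then have "push F' g = 0"
    proof (induction rule: push_eq_zero_induct)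
      case (binomial b s t q)
      \<comment> \<open>The terms of \<open>g\<close> all have degree \<open>e\<close>, which is at
        most \<open>k\<close>, so \<open>t\<close> arises from \<open>s\<close> by one move with
        trivial cofactor.\<close>
      have "R s t"
        unfolding R_def using binomial keys e
        by (intro exI[of _ 0] exI[of _ s] exI[of _ t]) (auto simp: homogeneous_of_degree_def)
      then have "F' s = F' t"
        by (simp add: F'_eq_iff r_into_rtranclp)
      then show ?case
        using binomial.IH by simp
    qed simp
    with keys show "g \<in> toric V F'"
      by (simp add: toric_def)
  qed
  then have sub: "(toric V FV :: ('v, 'a) mpoly set) \<subseteq> toric V F'"
    unfolding G_gen by (rule Idl_least[OF G ideal_F'])
  have connected: "R\<^sup>*\<^sup>* s t" if "s \<in> pps V" "t \<in> pps V" "FV s = FV t" for s t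
  proof -
    have "(unit_binomial s t :: ('v, 'a) mpoly) \<in> toric V F'"
      using sub that unit_binomial_in_toric_iff by blast
    then show ?thesis
      using that by (simp add: unit_binomial_in_toric_iff F'_eq_iff)
  qed
  \<comment> \<open>A path downstairs is followed upstairs from \<open>t\<close>; each lifted step
    is a move of degree at most \<open>k\<close> that keeps the image under
    \<open>FW\<close>.\<close>
  have lift: "\<exists>t'\<in>pps W. push c t' = v \<and> FW t' = FW t \<and> eqv t t'"
    if "R\<^sup>*\<^sup>* (push c t) v" "t \<in> pps W" for t v
    using that(1)
  proof (induction rule: rtranclp_induct)
    case base
    then show ?case
      using that(2) eqv_refl by blast
  next
    case (step y z)
    then obtain t' where t': "t' \<in> pps W" "push c t' = y" "FW t' = FW t" "eqv t t'"
      by blast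
    obtain u a b where uab: "u \<in> pps V" "a \<in> pps V" "b \<in> pps V" "y = u + a" "z = u + b"
      "FV a = FV b" "int (pp_degree a) \<le> k"
      using step.hyps(2) unfolding R_def by blast
    obtain u' a' b' where lifted: "u' \<in> pps W" "a' \<in> pps W" "b' \<in> pps W" "t' = u' + a'"
      "push c u' = u" "push c a' = a" "push c b' = b" "FW a' = FW b'"
      using lift_move[OF t'(1) t'(2)[unfolded uab(4)] uab(3,6)] .
    have "eqv t' (u' + b')"
      unfolding lifted(4) using lifted uab(7) by (intro eqv_move) auto
    then have "eqv t (u' + b')"
      using t'(4) eqv_trans by blast
    then show ?case
      using lifted t' uab by (intro bexI[of _ "u' + b'"]) auto
  qed
  have eqv: "eqv s t" if "s \<in> pps W" "t \<in> pps W" "FW s = FW t" for s t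
  proof -
    have "R\<^sup>*\<^sup>* (push c s) (push c t)"
      using that by (intro connected push_c_in_pps FV_push_eq_if_FW_eq)
    from lift[OF this that(1)] obtain s' where "s' \<in> pps W" "push c s' = push c t"
      "FW s' = FW s" "eqv s s'"
      by blast
    moreover from this have "eqv s' t"
      using that by (intro swap) auto
    ultimately show ?thesis
      using eqv_trans by blast
  qed
  have "p \<in> ?I" if "p \<in> toric W FW" for p :: "('w, 'a) mpoly"
  proof -
    have "push FW p = 0"
      using that by (simp add: toric_def)
    then show ?thesis
    proof (induction rule: push_eq_zero_induct)
      case (binomial b s t q)
      then have "eqv t s"
        using that by (intro eqv) (auto simp: toric_def)
      then have "Poly_Mapping.single 0 b * unit_binomial t s \<in> ?I"
        unfolding eqv_def by (rule Idl_mult_single[OF B zero_in_pps])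
      then show ?case
        using Idl_add[OF B] binomial.IH by (simp add: single_mult_unit_binomial)
    qed (rule Idl_zero[OF B])
  qed
  moreover have "?I \<subseteq> toric W FW"
    by (rule Idl_least[OF B ideal_toric_FW binomials_le_subset])
  ultimately have "toric W FW = ?I"
    by blast
  then show ?thesis
    unfolding generated_in_degrees_le_def using B degree_keys_binomials_le by metis
qed

text \<open>
  Ties are broken by the reversed lexicographic order.  Zero is still the least element, since
  only power products of the same degree are compared in this way.
\<close>

definition lift_order :: "('v pp \<times> 'v pp) set \<Rightarrow> ('w pp \<times> 'w pp) set" where
  "lift_order r = {(s, t). s \<in> pps W \<and> t \<in> pps W \<and> (push c s, push c t) \<in> r \<and>
    (push c s = push c t \<longrightarrow> push key t \<le> push key s)}"

lemma term_order_lift_order: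
  assumes "term_order V r"
  shows "term_order W (lift_order r)"
proof -
  have lin: "refl_on (pps V) r" "trans r" "antisym r" "total_on (pps V) r"
    and zero: "\<And>t. t \<in> pps V \<Longrightarrow> (0, t) \<in> r"
    and add: "\<And>s t u. s \<in> pps V \<Longrightarrow> t \<in> pps V \<Longrightarrow> u \<in> pps V \<Longrightarrow> (s, t) \<in> r \<Longrightarrow> (s + u, t + u) \<in> r"
    using assms by (auto simp: term_order_def order_on_defs)
  have "refl_on (pps W) (lift_order r)"
    using lin(1) by (auto simp: refl_on_def lift_order_def push_c_in_pps)
  moreover have "trans (lift_order r)"
  proof (rule transI)
    fix s t u assume st: "(s, t) \<in> lift_order r" and tu: "(t, u) \<in> lift_order r"
    then have rs: "(push c s, push c t) \<in> r" "(push c t, push c u) \<in> r"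
      by (auto simp: lift_order_def)
    then have "(push c s, push c u) \<in> r"
      using lin(2) by (rule transD[rotated])
    moreover have "push key u \<le> push key s" if "push c s = push c u"
    proof -
      \<comment> \<open>\<open>push c t\<close> lies between the equal \<open>push c s\<close> and
        \<open>push c u\<close>, so all three agree and the tie-breaks compose.\<close>
      have "push c s = push c t"
        using rs that lin(3) by (auto dest: antisymD)
      then show ?thesis
        using that st tu by (auto simp: lift_order_def)
    qed
    ultimately show "(s, u) \<in> lift_order r"
      using st tu by (auto simp: lift_order_def)
  qed
  moreover have "antisym (lift_order r)"
  proof (rule antisymI)
    fix s t assume st: "(s, t) \<in> lift_order r" and ts: "(t, s) \<in> lift_order r"
    then have "push c s = push c t"
      using lin(3) by (auto simp: lift_order_def dest: antisymD)
    then have "push key s = push key t"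
      using st ts by (auto simp: lift_order_def)
    then show "s = t"
      using st by (auto simp: lift_order_def push_key_eq_iff)
  qed
  moreover have "total_on (pps W) (lift_order r)"
  proof (rule total_onI)
    fix s t assume "s \<in> pps W" "t \<in> pps W" "s \<noteq> t"
    then show "(s, t) \<in> lift_order r \<or> (t, s) \<in> lift_order r"
      using lin(1,4) push_c_in_pps
      by (cases "push c s = push c t") (auto simp: lift_order_def total_on_def refl_on_def)
  qed
  moreover have "lift_order r \<subseteq> pps W \<times> pps W"
    by (auto simp: lift_order_def)
  moreover have "(0, t) \<in> lift_order r" if "t \<in> pps W" for t
    using that zero push_c_in_pps push_pp_eq_zero_iff[of c t]
    by (auto simp: lift_order_def)
  moreover have "(s + u, t + u) \<in> lift_order r"
    if "s \<in> pps W" "t \<in> pps W" "u \<in> pps W" "(s, t) \<in> lift_order r" for s t u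
    using that add push_c_in_pps by (auto simp: lift_order_def)
  ultimately show ?thesis
    by (simp add: term_order_def order_on_defs)
qed

lemma finite_binomials_le: "finite (binomials_le k :: ('w, 'a::comm_ring_1) mpoly set)"
proof -
  let ?T = "{t \<in> pps W. pp_degree t \<le> nat k}"
  have "(binomials_le k :: ('w, 'a) mpoly set) \<subseteq> (\<lambda>(t, s). unit_binomial t s) ` (?T \<times> ?T)"
  proof
    fix g :: "('w, 'a) mpoly" assume "g \<in> binomials_le k"
    then obtain s t where "g = unit_binomial t s" "s \<in> pps W" "t \<in> pps W" "FW s = FW t"
      "int (pp_degree t) \<le> k"
      by (auto simp: binomials_le_def)
    moreover from this have "pp_degree s = pp_degree t"
      by (intro degree_eq_if_FW_eq)
    ultimately show "g \<in> (\<lambda>(t, s). unit_binomial t s) ` (?T \<times> ?T)"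
      by (intro image_eqI[of _ _ "(t, s)"]) auto
  qed
  then show ?thesis
    by (rule finite_subset) (intro finite_imageI finite_cartesian_product finite_pps_degree_le finite_W)
qed

text \<open>The leading power product \<open>t\<close> of a kernel element shares its image with
  another term \<open>s\<close>. If their collapses agree, the tie-break and a swap provide a
  quadratic binomial whose leading power product divides \<open>t\<close>. Otherwise
  \<open>push c t\<close> leads a binomial downstairs, so it is divisible by a leading power product
  from \<open>G\<close>, and the corresponding move is lifted.\<close>

theorem has_binomial_groebner_basis_le_lift:
  assumes gb: "has_binomial_groebner_basis_le V k (toric V FV :: ('v, 'a::field) mpoly set)"
    and k: "k \<ge> 2"
  shows "has_binomial_groebner_basis_le W k (toric W FW :: ('w, 'a) mpoly set)"
proof -
  obtain r and G :: "('v, 'a) mpoly set" where r: "term_order V r"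
    and G: "G \<subseteq> toric V FV" and init: "initial_ideal V r G = initial_ideal V r (toric V FV)"
    and G_binom: "\<And>g. g \<in> G \<Longrightarrow> binomial g"
    and G_le: "\<And>g t. g \<in> G \<Longrightarrow> t \<in> Poly_Mapping.keys g \<Longrightarrow> int (pp_degree t) \<le> k"
    using gb unfolding has_binomial_groebner_basis_le_def groebner_basis_def by metis
  let ?r = "lift_order r"
  let ?B = "binomials_le k :: ('w, 'a) mpoly set"
  note r' = term_order_lift_order[OF r]
  have B: "?B \<subseteq> carrier (mpoly_ring W)"
    using binomials_le_subset toric_subset_carrier by blast
  have lead: "power_monomial (u + a) \<in> initial_ideal W ?r ?B"
    if "u \<in> pps W" "a \<in> pps W" "b \<in> pps W" "a \<noteq> b" "FW a = FW b" "int (pp_degree a) \<le> k"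
      "(b, a) \<in> ?r" for u a b
  proof -
    have "(a, a) \<in> ?r"
      using r' that by (auto simp: term_order_def order_on_defs refl_on_def)
    then have "leading_pp ?r (unit_binomial a b :: ('w, 'a) mpoly) = a"
      using that by (intro leading_pp_eqI[OF r']) (auto simp: keys_unit_binomial)
    moreover have "(unit_binomial a b :: ('w, 'a) mpoly) \<in> ?B - {0}"
      using that keys_unit_binomial[of b a, where 'a = 'a] by (fastforce simp: binomials_le_def)
    moreover have "u + a \<in> pps W"
      using that by simp
    ultimately show ?thesis
      using that(1) power_monomial_in_initial_ideal_iff[OF r' B] by metis
  qed
  have main: "power_monomial (leading_pp ?r p) \<in> initial_ideal W ?r ?B"
    if p: "p \<in> toric W FW" "p \<noteq> 0" for p :: "('w, 'a) mpoly"
  proof -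
    define t where "t = leading_pp ?r p"
    have keys: "Poly_Mapping.keys p \<subseteq> pps W" and "push FW p = 0"
      using p by (auto simp: toric_def)
    have t: "t \<in> Poly_Mapping.keys p" and t_max: "\<And>s. s \<in> Poly_Mapping.keys p \<Longrightarrow> (s, t) \<in> ?r"
      unfolding t_def using leading_pp_is_max[OF r' p(2) keys] by auto
    obtain s where s: "s \<in> Poly_Mapping.keys p" "s \<noteq> t" "FW s = FW t"
      using push_eq_zero_partner[OF \<open>push FW p = 0\<close> t] .
    have in_W: "s \<in> pps W" "t \<in> pps W"
      using s t keys by auto
    have st: "(push c s, push c t) \<in> r" "push c s = push c t \<longrightarrow> push key t \<le> push key s"
      using t_max[OF s(1)] by (auto simp: lift_order_def)
    have "power_monomial t \<in> initial_ideal W ?r ?B"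
    proof (cases "push c s = push c t")
      case True
      then have less: "push key t < push key s"
        using st(2) push_key_eq_iff[OF in_W] s(2) by auto
      obtain u q q' where uq: "u \<in> pps W" "q \<in> pps W" "q' \<in> pps W" "t = u + q"
        "push c q = push c q'" "FW q = FW q'" "push key q < push key q'" "pp_degree q = 2"
        using quadratic_swap[OF in_W True s(3) less] .
      \<comment> \<open>The tie-break is reversed, so the smaller \<open>push key q\<close> makes
        \<open>q\<close> the leading power product.\<close>
      have "(push c q, push c q) \<in> r"
        using r push_c_in_pps[OF uq(2)] by (auto simp: term_order_def order_on_defs refl_on_def)
      then have "(q', q) \<in> ?r"
        using uq by (auto simp: lift_order_def)
      then show ?thesis
        unfolding uq(4) using uq k by (intro lead[of u q q']) auto
    next
      case False
      let ?f = "unit_binomial (push c t) (push c s) :: ('v, 'a) mpoly"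
      have in_V: "push c t \<in> pps V" "push c s \<in> pps V"
        using in_W push_c_in_pps by auto
      have "(push c t, push c t) \<in> r"
        using r in_V by (auto simp: term_order_def order_on_defs refl_on_def)
      then have "leading_pp r ?f = push c t"
        using st False by (intro leading_pp_eqI[OF r]) (auto simp: keys_unit_binomial)
      moreover have "?f \<in> toric V FV - {0}"
        using in_V FV_push_eq_if_FW_eq[OF in_W s(3)] False
          keys_unit_binomial[of "push c s" "push c t", where 'a = 'a]
        by (auto simp: unit_binomial_in_toric_iff)
      ultimately have "power_monomial (push c t) \<in> initial_ideal V r (toric V FV :: ('v, 'a) mpoly set)"
        using power_monomial_in_initial_ideal_iff[OF r toric_subset_carrier in_V(1)]
        by (metis add_0 zero_in_pps)
      then have "power_monomial (push c t) \<in> initial_ideal V r G"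
        using init by simp
      then obtain g u where g: "g \<in> G" "g \<noteq> 0" and u: "u \<in> pps V" "push c t = u + leading_pp r g"
        using power_monomial_in_initial_ideal_iff[OF r _ in_V(1), of G]
          order.trans[OF G toric_subset_carrier] by auto
      define a where "a = leading_pp r g"
      have "g \<in> toric V FV"
        using g G by blast
      then have keys_g: "Poly_Mapping.keys g \<subseteq> pps V" and push_g: "push FV g = 0"
        by (auto simp: toric_def)
      have a: "a \<in> Poly_Mapping.keys g" "\<And>b. b \<in> Poly_Mapping.keys g \<Longrightarrow> (b, a) \<in> r"
        unfolding a_def using leading_pp_is_max[OF r g(2) keys_g] by auto
      \<comment> \<open>The coefficients of \<open>g\<close> are arbitrary, so only its power
        products are used: \<open>a\<close> and a partner \<open>b\<close> with equal image. The
        lifted pair gives a pure difference in \<open>?B\<close>.\<close>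
      obtain b where b: "b \<in> Poly_Mapping.keys g" "b \<noteq> a" "FV b = FV a"
        using push_eq_zero_partner[OF push_g a(1)] .
      obtain u' a' b' where lifted: "u' \<in> pps W" "a' \<in> pps W" "b' \<in> pps W" "t = u' + a'"
        "push c u' = u" "push c a' = a" "push c b' = b" "FW a' = FW b'"
        using lift_move[OF in_W(2) u(2)[folded a_def] subsetD[OF keys_g b(1)] b(3)[symmetric]] .
      have "(b', a') \<in> ?r"
        using lifted a(2)[OF b(1)] b(2) by (auto simp: lift_order_def)
      moreover have "pp_degree a' = pp_degree a"
        using pp_degree_push[of c a'] lifted(6) by simp
      ultimately show ?thesis
        unfolding lifted(4) using lifted b(2) G_le[OF g(1) a(1)] by (intro lead[of u' a' b']) auto
    qed
    then show ?thesis
      by (simp add: t_def)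
  qed
  have "initial_ideal W ?r ?B = initial_ideal W ?r (toric W FW)"
  proof
    have lead_in: "(\<lambda>p. power_monomial (leading_pp ?r p)) ` (A - {0}) \<subseteq> carrier (mpoly_ring W)"
      if "A \<subseteq> carrier (mpoly_ring W)" for A :: "('w, 'a) mpoly set"
      using that leading_pp_is_max(1)[OF r']
      by (fastforce simp: carrier_mpoly_ring power_monomial_def)
    interpret cring "mpoly_ring W :: ('w, 'a) mpoly ring"
      by (rule cring_mpoly_ring)
    show "initial_ideal W ?r ?B \<subseteq> initial_ideal W ?r (toric W FW)"
      unfolding initial_ideal_def using binomials_le_subset
      by (intro genideal_minimal genideal_ideal lead_in toric_subset_carrier
          order.trans[OF _ genideal_self[OF lead_in]]) blast+
    have "ideal (initial_ideal W ?r ?B) (mpoly_ring W)"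
      unfolding initial_ideal_def by (intro genideal_ideal lead_in B)
    then show "initial_ideal W ?r (toric W FW) \<subseteq> initial_ideal W ?r ?B"
      unfolding initial_ideal_def[of W ?r "toric W FW"]
      by (rule genideal_minimal) (use main in auto)
  qed
  then have "groebner_basis W ?r ?B (toric W FW)"
    using finite_binomials_le binomials_le_subset by (auto simp: groebner_basis_def)
  moreover have "binomial g \<and> (\<forall>t\<in>Poly_Mapping.keys g. int (pp_degree t) \<le> k)" if "g \<in> ?B" for g
    by (rule degree_keys_binomials_le[OF that]) (simp add: homogeneous_of_degree_def)
  ultimately show ?thesis
    unfolding has_binomial_groebner_basis_le_def using r' by blast
qed

end

subsection \<open>Monomial projections\<close>

lemma power_monomial_zero: "power_monomial 0 = 1"
  by (simp add: power_monomial_def)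

lemma power_monomial_add: "power_monomial (s + t) = power_monomial s * power_monomial t"
  by (simp add: power_monomial_def mult_single)

lemma power_monomial_sum: "power_monomial (\<Sum>x\<in>S. f x) = (\<Prod>x\<in>S. power_monomial (f x))"
  by (induction S rule: infinite_finite_induct) (simp_all add: power_monomial_zero power_monomial_add)

lemma power_monomial_pp_extend:
  "power_monomial (pp_extend e t) =
    (\<Prod>v\<in>Poly_Mapping.keys t. power_monomial (e v) ^ Poly_Mapping.lookup t v)"
  by (simp add: pp_extend_def power_monomial_sum)

text \<open>When variables go to monomials, power products go to monomials, so the homomorphism only
  relabels terms and adds up coefficients.\<close>

lemma mpoly_hom_eq_push:
  assumes "Poly_Mapping.keys p \<subseteq> pps V" "\<And>v. v \<in> V \<Longrightarrow> \<sigma> v = power_monomial (e v)"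
  shows "mpoly_hom \<sigma> p = push (pp_extend e) p"
proof -
  have "(\<Prod>v\<in>Poly_Mapping.keys t. \<sigma> v ^ Poly_Mapping.lookup t v) = power_monomial (pp_extend e t)"
    if "t \<in> Poly_Mapping.keys p" for t
  proof -
    have "Poly_Mapping.keys t \<subseteq> V"
      using that assms(1) by (auto simp: pps_def)
    then show ?thesis
      unfolding power_monomial_pp_extend by (intro prod.cong) (auto simp: assms(2) subsetD)
  qed
  then show ?thesis
    unfolding mpoly_hom_def push_def
    by (intro sum.cong) (simp_all add: power_monomial_def mult_single)
qed

text \<open>The ambient variables are monomials in the form of polynomials; this recovers their
  exponent vectors.\<close>

definition exponent :: "('v, 'a::comm_ring_1) mpoly \<Rightarrow> 'v pp" where
  "exponent = inv_into UNIV power_monomial"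

lemma inj_power_monomial: "inj (power_monomial :: 'v pp \<Rightarrow> ('v, 'a::comm_ring_1) mpoly)"
proof (rule injI)
  fix s t :: "'v pp"
  assume "power_monomial s = (power_monomial t :: ('v, 'a) mpoly)"
  then have "Poly_Mapping.keys (power_monomial s :: ('v, 'a) mpoly) =
      Poly_Mapping.keys (power_monomial t :: ('v, 'a) mpoly)"
    by simp
  then show "s = t"
    by (simp add: power_monomial_def)
qed

lemma exponent_power_monomial [simp]: "exponent (power_monomial t) = t"
  by (simp add: exponent_def inj_power_monomial inv_f_f)

lemma projection_ideal_eq_toric:
  assumes "\<Omega> \<subseteq> range power_monomial"
  shows "projection_ideal V \<Omega> = toric \<Omega> (pp_extend exponent)"
proof -
  have "mpoly_hom (\<lambda>m. m) p = push (pp_extend exponent) p"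
    if "Poly_Mapping.keys p \<subseteq> pps \<Omega>" for p
    using that by (rule mpoly_hom_eq_push) (use assms in auto)
  then show ?thesis
    by (auto simp: projection_ideal_def a_kernel_def' toric_def carrier_mpoly_ring)
qed

lemma collapse_hom_power_monomial:
  "collapse_hom (power_monomial M) = power_monomial (push fst M)"
proof -
  have "collapse_hom (power_monomial M) = push (pp_extend (\<lambda>x. pp_var (fst x))) (power_monomial M)"
    unfolding collapse_hom_def
    by (rule mpoly_hom_eq_push[of _ UNIV]) (auto simp: pps_def mpoly_var_def pp_var_def)
  moreover have "pp_extend (\<lambda>x. pp_var (fst x)) M = push fst M"
    by (induction M rule: pp_induct) auto
  ultimately show ?thesis
    by (simp add: power_monomial_def)
qed

lemma finite_split_vars: "finite (split_vars n l)"
proof -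
  have "split_vars n l \<subseteq> (\<Union>i\<le>n. {i} \<times> {..l i})"
    by (auto simp: split_vars_def)
  then show ?thesis
    by (rule finite_subset) auto
qed

text \<open>The bound \<open>k \<ge> 2\<close> is essential: for the single monomial
  \<open>x_0 x_1\<close> the lower ideal is zero, but with two copies of each variable the upper
  ideal is generated by a quadric, the 2 by 2 determinant.\<close>

theorem lemma4p14:
  fixes n d N :: nat and l :: "nat \<Rightarrow> nat" and k :: int
    and \<Omega>n :: "(nat, 'a::field) mpoly set"
    and \<Omega>N :: "(nat \<times> nat, 'a) mpoly set"
  assumes "n > 0" and "d > 0"
    and "\<forall>i\<le>n. l i > 0"
    and "N + 1 = (\<Sum>i\<le>n. l i)"
    and "\<Omega>n \<subseteq> monomials_of_degree {..n} d"
    and "\<Omega>N = {m \<in> monomials (split_vars n l). collapse_hom m \<in> \<Omega>n}"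
    and "k \<ge> 2"
  shows "(generated_in_degrees_le \<Omega>n k (projection_ideal {..n} \<Omega>n) \<longrightarrow>
          generated_in_degrees_le \<Omega>N k (projection_ideal (split_vars n l) \<Omega>N)) \<and>
         (has_binomial_groebner_basis_le \<Omega>n k (projection_ideal {..n} \<Omega>n) \<longrightarrow>
          has_binomial_groebner_basis_le \<Omega>N k (projection_ideal (split_vars n l) \<Omega>N))"
proof -
  have \<Omega>n: "\<exists>t. m = power_monomial t \<and> pp_degree t = d" if "m \<in> \<Omega>n" for m
    using that assms(5) by (auto simp: monomials_of_degree_def)
  have \<Omega>N: "\<exists>M\<in>pps (split_vars n l). m = power_monomial M \<and> power_monomial (push fst M) \<in> \<Omega>n"
    if "m \<in> \<Omega>N" for m
    using that assms(6) by (auto simp: monomials_def collapse_hom_power_monomial)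
  \<comment> \<open>The ambient variables are the monomials themselves, so
    \<open>collapse_hom\<close> acts on them directly, while \<open>fst\<close> collapses the
    underlying variables.\<close>
  interpret graded_monomial_lifting \<Omega>n \<Omega>N "split_vars n l" fst collapse_hom exponent exponent d
  proof
    show "collapse_hom w \<in> \<Omega>n" "exponent w \<in> pps (split_vars n l)"
      "push fst (exponent w) = exponent (collapse_hom w)" if "w \<in> \<Omega>N" for w
      using \<Omega>N[OF that] by (auto simp: collapse_hom_power_monomial)
    show "inj_on exponent \<Omega>N"
      by (rule inj_onI) (metis \<Omega>N exponent_power_monomial)
    \<comment> \<open>\<open>\<Omega>N\<close> is the full preimage, so
      \<open>power_monomial M\<close> itself is the required variable.\<close>
    show "\<exists>w\<in>\<Omega>N. collapse_hom w = v \<and> exponent w = M"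
      if "v \<in> \<Omega>n" "M \<in> pps (split_vars n l)" "push fst M = exponent v" for v M
    proof -
      have "power_monomial (push fst M) = v"
        using that(3) \<Omega>n[OF that(1)] by auto
      then show ?thesis
        using that assms(6)
        by (intro bexI[of _ "power_monomial M"]) (auto simp: collapse_hom_power_monomial monomials_def)
    qed
    \<comment> \<open>The collapse preserves degrees, so \<open>\<Omega>N\<close> consists of
      monomials of degree \<open>d\<close> in finitely many variables.\<close>
    show "finite \<Omega>N"
    proof (rule finite_subset)
      show "\<Omega>N \<subseteq> power_monomial ` {M \<in> pps (split_vars n l). pp_degree M \<le> d}"
      proof
        fix m assume "m \<in> \<Omega>N"
        then obtain M where M: "M \<in> pps (split_vars n l)" "m = power_monomial M"
          "power_monomial (push fst M) \<in> \<Omega>n"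
          using \<Omega>N by blast
        then obtain t where "(power_monomial (push fst M) :: (nat, 'a) mpoly) = power_monomial t"
          "pp_degree t = d"
          using \<Omega>n by blast
        then have "pp_degree (push fst M) = d"
          using inj_power_monomial by (auto dest: injD)
        then show "m \<in> power_monomial ` {M \<in> pps (split_vars n l). pp_degree M \<le> d}"
          using M by simp
      qed
    qed (intro finite_imageI finite_pps_degree_le finite_split_vars)
    show "pp_degree (exponent v) = d" if "v \<in> \<Omega>n" for v
      using \<Omega>n[OF that] by auto
  qed fact
  have "\<Omega>n \<subseteq> range power_monomial" "\<Omega>N \<subseteq> range power_monomial"
    using \<Omega>n \<Omega>N by blast+
  note this[THEN projection_ideal_eq_toric]
  then show ?thesis
    using generated_in_degrees_le_lift has_binomial_groebner_basis_le_lift \<open>k \<ge> 2\<close> by metis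
qed

end
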